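(* Let $m$ be any positive rational number and let $\Lambda=\left(\frac{g_{5m}}{g_{m/5}}\right)^3$. Write $a=a_{m,5}$, $b=b_{4m,5}$, $S=\sqrt{a/b}-\sqrt{b/a}$, $T=\frac{1}{\sqrt{ab}}-\sqrt{ab}$ and $L=\Lambda-\frac1\Lambda$. Then $$S^2=S\,L-4,\qquad 25T^2=5T\left(L^3-6L\right)+L^4-37L^2-64.$$
   Context: For $|q|<1$: $\varphi(q)=\sum_{n\in\mathbb Z}q^{n^2}$, $\psi(q)=\sum_{n\ge0}q^{n(n+1)/2}$, $(a;q)_\infty=\prod_{k\ge0}(1-aq^k)$, $\chi(q)=(-q;q^2)_\infty$. For positive rational $r$, the Ramanujan class invariant is $g_r=2^{-1/4}q^{-1/24}\chi(-q)$ with $q=e^{-\pi\sqrt r}$. For positive rationals $m,n$, $$a_{m,n}=\frac{n\,q^{(n-1)/4}\psi^2(q^n)\varphi^2(-q^{2n})}{\psi^2(q)\varphi^2(-q^2)},\quad q=e^{-\pi\sqrt{m/n}},$$ and $$b_{m,n}=\frac{n\,q^{(n-1)/4}\psi^2(q^n)\varphi^2(-q^{n})}{\psi^2(q)\varphi^2(-q)},\quad q=e^{-\pi\sqrt{m/n}}.$$ *)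

theory Defs
  imports "HOL-Analysis.Analysis"
begin

(* The series and products below converge for norm q < 1 only; values elsewhere are junk. *)

definition theta_phi :: "'a::{real_normed_field,banach} \<Rightarrow> 'a" where
  "theta_phi q = (\<Sum>\<^sub>\<infinity>n\<in>(UNIV :: int set). q powi (n\<^sup>2))"

definition theta_psi :: "'a::{real_normed_field,banach} \<Rightarrow> 'a" where
  "theta_psi q = (\<Sum>n::nat. q ^ (n * (n + 1) div 2))"

definition q_pochhammer_inf :: "'a::{real_normed_field,banach} \<Rightarrow> 'a \<Rightarrow> 'a" where
  "q_pochhammer_inf a q = (\<Prod>k. 1 - a * q ^ k)"

definition chi :: "'a::{real_normed_field,banach} \<Rightarrow> 'a" where
  "chi q = q_pochhammer_inf (- q) (q\<^sup>2)"

(* The index parameters r, m, n of the next three functions range over the positive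
   rationals, embedded in the reals. *)

definition class_g :: "real \<Rightarrow> real" where
  "class_g r = (let q = exp (- pi * sqrt r) in
     2 powr (- 1 / 4) * q powr (- 1 / 24) * chi (- q))"

definition a_par :: "real \<Rightarrow> real \<Rightarrow> real" where
  "a_par m n = (let q = exp (- pi * sqrt (m / n)) in
     n * q powr ((n - 1) / 4) * (theta_psi (q powr n))\<^sup>2 * (theta_phi (- (q powr (2 * n))))\<^sup>2
       / ((theta_psi q)\<^sup>2 * (theta_phi (- (q\<^sup>2)))\<^sup>2))"

definition b_par :: "real \<Rightarrow> real \<Rightarrow> real" where
  "b_par m n = (let q = exp (- pi * sqrt (m / n)) in
     n * q powr ((n - 1) / 4) * (theta_psi (q powr n))\<^sup>2 * (theta_phi (- (q powr n)))\<^sup>2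
       / ((theta_psi q)\<^sup>2 * (theta_phi (- q))\<^sup>2))"

end

theory Submission
  imports Defs
begin

text \<open>
  Write \<open>f\<^sub>k\<close> for the Euler product of \<open>q\<^sup>k\<close>. The Jacobi triple product turns
  \<open>\<phi>\<close>, \<open>\<psi>\<close> and \<open>\<chi>\<close> into quotients of the \<open>f\<^sub>k\<close>. Splitting the lattice of exponents of
  \<open>\<phi>\<^sup>2\<close> and \<open>\<psi>\<^sup>2\<close> by the residue of \<open>2x - y\<close> modulo 5 shows that
  \<open>t = \<psi>\<^sup>2(q) / (q \<psi>\<^sup>2(q\<^sup>5))\<close> has the property that \<open>t - 1\<close> and \<open>t - 5\<close> are again quotients of the
  \<open>f\<^sub>k\<close>. Hence \<open>\<Lambda>\<^sup>2 = t (t - 1) / (t - 5)\<close> and \<open>\<surd>(ab) = 5 \<Lambda> / t\<^sup>2\<close>, which is the identity for T.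
  With \<open>u = t(q\<^sup>2)\<close> one has \<open>a / b = u / t\<close>, and comparing two expressions for \<open>\<surd>(a / b) / \<Lambda>\<close> gives
  \<open>u\<^sup>2 - (t\<^sup>2 - 4t + 5) u + t\<^sup>2 = 0\<close>, from which the identity for S follows.
\<close>

section \<open>Infinite q-Pochhammer symbols\<close>

lemma q_pochhammer_inf_LIMSEQ:
  fixes a q :: real
  assumes "\<bar>q\<bar> < 1"
  shows "(\<lambda>n. \<Prod>k<n. 1 - a * q ^ k) \<longlonglongrightarrow> q_pochhammer_inf a q"
    and "convergent_prod (\<lambda>k. 1 - a * q ^ k)"
proof -
  have "summable (\<lambda>k. norm ((1 - a * q ^ k) - 1))"
    using assms by (auto simp: abs_mult power_abs intro!: summable_mult summable_geometric)
  then show c: "convergent_prod (\<lambda>k. 1 - a * q ^ k)"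
    by (intro abs_convergent_prod_imp_convergent_prod) (simp add: abs_convergent_prod_conv_summable)
  \<comment> \<open>\<open>convergent_prod_LIMSEQ\<close> speaks of products over k \<le> n, hence
    the index shift.\<close>
  have "(\<lambda>n. \<Prod>k<Suc n. 1 - a * q ^ k) \<longlonglongrightarrow> q_pochhammer_inf a q"
    using convergent_prod_LIMSEQ[OF c] by (simp add: q_pochhammer_inf_def lessThan_Suc_atMost)
  then show "(\<lambda>n. \<Prod>k<n. 1 - a * q ^ k) \<longlonglongrightarrow> q_pochhammer_inf a q"
    by (rule LIMSEQ_imp_Suc)
qed

lemma q_pochhammer_inf_pos:
  fixes a q :: real
  assumes "\<bar>q\<bar> < 1" "\<bar>a\<bar> < 1"
  shows "q_pochhammer_inf a q > 0"
  unfolding q_pochhammer_inf_def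
proof (rule less_0_prodinf)
  show "convergent_prod (\<lambda>k. 1 - a * q ^ k)"
    by (rule q_pochhammer_inf_LIMSEQ) fact
  fix i
  have "\<bar>q\<bar> ^ i \<le> 1" using assms by (simp add: power_le_one)
  then have "\<bar>a * q ^ i\<bar> \<le> \<bar>a\<bar>"
    by (simp add: abs_mult power_abs mult_left_le)
  then show "1 - a * q ^ i > 0" using assms by linarith
qed

text \<open>The factors are sorted by the residue of their index k modulo m. The sorting is exact
  for partial products of length n * m, and these form a subsequence with the same limit.\<close>

lemma q_pochhammer_inf_group:
  fixes a q :: real
  assumes "\<bar>q\<bar> < 1" "m > 0"
  shows "q_pochhammer_inf a q = (\<Prod>i<m. q_pochhammer_inf (a * q ^ i) (q ^ m))"
proof -
  have qm: "\<bar>q ^ m\<bar> < 1"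
    using assms by (simp add: power_abs power_less_one_iff)
  have split: "(\<Prod>k<N + j. f k) = (\<Prod>k<N. f k) * (\<Prod>i<j. f (N + i))" for N j and f :: "nat \<Rightarrow> real"
    by (induction j) (simp_all add: mult.assoc)
  have fin: "(\<Prod>k<n * m. 1 - a * q ^ k) = (\<Prod>i<m. \<Prod>k<n. 1 - a * q ^ i * (q ^ m) ^ k)" for n
  proof (induction n)
    case (Suc n)
    have "(\<Prod>k<Suc n * m. 1 - a * q ^ k) = (\<Prod>k<n * m + m. 1 - a * q ^ k)"
      by (simp add: add.commute)
    also have "\<dots> = (\<Prod>k<n * m. 1 - a * q ^ k) * (\<Prod>i<m. 1 - a * q ^ (n * m + i))"
      by (rule split)
    also have "(\<Prod>i<m. 1 - a * q ^ (n * m + i)) = (\<Prod>i<m. 1 - a * q ^ i * (q ^ m) ^ n)"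
      by (simp add: power_add power_mult[symmetric] mult_ac)
    finally show ?case
      by (simp add: Suc.IH prod.distrib)
  qed simp
  have "(\<lambda>n. \<Prod>k<n * m. 1 - a * q ^ k) \<longlonglongrightarrow> q_pochhammer_inf a q"
    using LIMSEQ_subseq_LIMSEQ[OF q_pochhammer_inf_LIMSEQ(1)[OF assms(1), of a], of "\<lambda>n. n * m"] assms
    by (simp add: strict_mono_def o_def)
  moreover have "(\<lambda>n. \<Prod>i<m. \<Prod>k<n. 1 - a * q ^ i * (q ^ m) ^ k)
      \<longlonglongrightarrow> (\<Prod>i<m. q_pochhammer_inf (a * q ^ i) (q ^ m))"
    by (intro tendsto_prod q_pochhammer_inf_LIMSEQ qm)
  ultimately show ?thesis
    unfolding fin by (rule LIMSEQ_unique)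
qed

text \<open>Factor by factor this is (1 - x) (1 + x) = 1 - x^2.\<close>

lemma q_pochhammer_inf_mult_minus:
  fixes a q :: real
  assumes "\<bar>q\<bar> < 1"
  shows "q_pochhammer_inf a q * q_pochhammer_inf (- a) q = q_pochhammer_inf (a\<^sup>2) (q\<^sup>2)"
proof -
  have "(\<lambda>n. (\<Prod>k<n. 1 - a * q ^ k) * (\<Prod>k<n. 1 - (- a) * q ^ k))
     \<longlonglongrightarrow> q_pochhammer_inf a q * q_pochhammer_inf (- a) q"
    by (intro tendsto_mult q_pochhammer_inf_LIMSEQ assms)
  moreover have "(\<Prod>k<n. 1 - a * q ^ k) * (\<Prod>k<n. 1 - (- a) * q ^ k)
     = (\<Prod>k<n. 1 - a\<^sup>2 * (q\<^sup>2) ^ k)" for n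
    by (simp add: prod.distrib[symmetric] algebra_simps power2_eq_square power_mult_distrib)
  moreover have "(\<lambda>n. \<Prod>k<n. 1 - a\<^sup>2 * (q\<^sup>2) ^ k) \<longlonglongrightarrow> q_pochhammer_inf (a\<^sup>2) (q\<^sup>2)"
    using assms by (intro q_pochhammer_inf_LIMSEQ) (simp add: abs_square_less_1)
  ultimately show ?thesis
    by (metis (no_types, lifting) LIMSEQ_unique ext)
qed

lemma q_pochhammer_inf_shift:
  fixes a q :: real
  assumes "\<bar>q\<bar> < 1"
  shows "q_pochhammer_inf a q = (1 - a) * q_pochhammer_inf (a * q) q"
proof -
  have "(\<lambda>n. (1 - a) * (\<Prod>k<n. 1 - a * q * q ^ k)) \<longlonglongrightarrow> (1 - a) * q_pochhammer_inf (a * q) q"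
    by (intro tendsto_intros q_pochhammer_inf_LIMSEQ assms)
  moreover have "(1 - a) * (\<Prod>k<n. 1 - a * q * q ^ k) = (\<Prod>k<Suc n. 1 - a * q ^ k)" for n
    by (simp add: prod.lessThan_Suc_shift mult.assoc del: prod.lessThan_Suc)
  ultimately show ?thesis
    using LIMSEQ_Suc[OF q_pochhammer_inf_LIMSEQ(1)[OF assms, of a]] LIMSEQ_unique by auto
qed

section \<open>The Jacobi triple product\<close>

definition q_fact :: "real \<Rightarrow> nat \<Rightarrow> real" where
  "q_fact p n = (\<Prod>i<n. 1 - p * p ^ i)"

definition gauss_binomial :: "real \<Rightarrow> nat \<Rightarrow> nat \<Rightarrow> real" where
  "gauss_binomial p N k = (if k \<le> N then q_fact p N / (q_fact p k * q_fact p (N - k)) else 0)"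

lemma q_fact_Suc: "q_fact p (Suc n) = q_fact p n * (1 - p ^ Suc n)"
  by (simp add: q_fact_def)

lemma q_fact_0 [simp]: "q_fact p 0 = 1"
  by (simp add: q_fact_def)

lemma q_fact_nonzero: "\<bar>p\<bar> < 1 \<Longrightarrow> q_fact p n \<noteq> 0"
proof -
  assume p: "\<bar>p\<bar> < 1"
  have "p * p ^ i \<noteq> 1" for i
  proof
    assume "p * p ^ i = 1"
    then have "\<bar>p\<bar> ^ Suc i = 1" by (metis abs_one power_Suc power_abs)
    with p show False
      by (metis abs_ge_zero less_irrefl power_less_one_iff zero_less_Suc)
  qed
  then show ?thesis by (simp add: q_fact_def)
qed

lemma gauss_binomial_0: "\<bar>p\<bar> < 1 \<Longrightarrow> gauss_binomial p N 0 = 1"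
  by (simp add: gauss_binomial_def q_fact_nonzero)

text \<open>One of the two q-Pascal rules. The power of p sits at the lower term so that it matches
  the last factor 1 + x p^N in the induction for the q-binomial theorem.\<close>

lemma gauss_binomial_Suc_Suc:
  assumes "\<bar>p\<bar> < 1" "k \<le> N"
  shows "gauss_binomial p (Suc N) (Suc k) =
           gauss_binomial p N (Suc k) + p ^ (N - k) * gauss_binomial p N k"
\<comment> \<open>For k = N the term with \<open>Suc k\<close> has the default value 0, and the
  other two Gaussian binomials are 1.\<close>
proof (cases "k = N")
  case True
  then show ?thesis using assms q_fact_nonzero[OF assms(1)] by (simp add: gauss_binomial_def)
next
  case False
  then obtain d where N: "N = k + Suc d"
    using assms by (metis add_Suc_right le_neq_implies_less less_imp_Suc_add)
  have nz: "q_fact p n \<noteq> 0" for n using assms q_fact_nonzero by blast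
  have nz': "1 - p ^ Suc n \<noteq> 0" for n
    using nz[of "Suc n"] unfolding q_fact_Suc by simp
  have "gauss_binomial p (Suc N) (Suc k) = q_fact p N * (1 - p ^ Suc N) /
      ((q_fact p k * (1 - p ^ Suc k)) * (q_fact p d * (1 - p ^ Suc d)))"
    using N by (simp add: gauss_binomial_def q_fact_Suc del: power_Suc)
  moreover have "gauss_binomial p N (Suc k) = q_fact p N /
      ((q_fact p k * (1 - p ^ Suc k)) * q_fact p d)"
    using N by (simp add: gauss_binomial_def q_fact_Suc del: power_Suc)
  moreover have "gauss_binomial p N k = q_fact p N / (q_fact p k * (q_fact p d * (1 - p ^ Suc d)))"
    using N by (simp add: gauss_binomial_def q_fact_Suc del: power_Suc)
  \<comment> \<open>With x = p^(k+1) and y = p^(d+1) the rule reduces to 1 - x y = (1 - y) + y (1 -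
    x).\<close>
  moreover have "Q * (1 - x * y) / (A * (1 - x) * (B * (1 - y))) =
      Q / (A * (1 - x) * B) + y * (Q / (A * (B * (1 - y))))"
    if "A \<noteq> 0" "B \<noteq> 0" "1 - x \<noteq> 0" "1 - y \<noteq> 0" for A B Q x y :: real
    using that by (simp add: divide_simps) (simp add: algebra_simps)
  moreover have "p ^ Suc N = p ^ Suc k * p ^ Suc d" "N - k = Suc d"
    using N by (simp_all add: power_add)
  ultimately show ?thesis
    using nz[of k] nz[of d] nz'[of k] nz'[of d] by (simp del: power_Suc)
qed

lemma q_binomial_theorem:
  fixes p x :: real
  assumes "\<bar>p\<bar> < 1"
  shows "(\<Prod>k<N. 1 + x * p ^ k) = (\<Sum>k\<le>N. gauss_binomial p N k * p ^ (k * (k - 1) div 2) * x ^ k)"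
proof (induction N)
  case 0
  then show ?case by (simp add: gauss_binomial_0 assms)
next
  case (Suc N)
  let ?g = "\<lambda>N k. gauss_binomial p N k * p ^ (k * (k - 1) div 2) * x ^ k"
  \<comment> \<open>The truncated subtraction is harmless at k = 0, where the factor k
    vanishes.\<close>
  have tri: "Suc k * (Suc k - 1) div 2 = k * (k - 1) div 2 + k" for k :: nat
    by (cases k) (simp_all add: algebra_simps)
  have step: "?g (Suc N) (Suc k) = ?g N (Suc k) + x * p ^ N * ?g N k" if "k \<le> N" for k
  proof -
    have pN: "p ^ (N - k) * p ^ k = p ^ N"
      using that by (simp add: power_add[symmetric])
    have "p ^ (N - k) * gauss_binomial p N k * p ^ (Suc k * (Suc k - 1) div 2) * x ^ Suc k
       = x * (p ^ (N - k) * p ^ k) * ?g N k"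
      unfolding tri by (simp add: power_add mult_ac)
    then show ?thesis
      unfolding gauss_binomial_Suc_Suc[OF assms that] pN by (simp only: distrib_right)
  qed
  have "(\<Sum>k\<le>Suc N. ?g (Suc N) k) = ?g (Suc N) 0 + (\<Sum>k\<le>N. ?g (Suc N) (Suc k))"
    by (rule sum.atMost_Suc_shift)
  also have "\<dots> = ?g N 0 + (\<Sum>k\<le>N. ?g N (Suc k)) + (\<Sum>k\<le>N. x * p ^ N * ?g N k)"
  proof -
    have "(\<Sum>k\<le>N. ?g (Suc N) (Suc k)) = (\<Sum>k\<le>N. ?g N (Suc k) + x * p ^ N * ?g N k)"
      by (rule sum.cong[OF refl], rule step) simp
    then show ?thesis
      by (simp add: sum.distrib gauss_binomial_0[OF assms] del: power_Suc)
  qed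
  also have "?g N 0 + (\<Sum>k\<le>N. ?g N (Suc k)) = (\<Sum>k\<le>Suc N. ?g N k)"
    by (rule sum.atMost_Suc_shift[symmetric])
  \<comment> \<open>The extra summand at \<open>Suc N\<close> is 0 by the default value of
    \<open>gauss_binomial\<close>.\<close>
  also have "\<dots> = (\<Sum>k\<le>N. ?g N k)"
    by (simp add: gauss_binomial_def)
  also have "(\<Sum>k\<le>N. ?g N k) + (\<Sum>k\<le>N. x * p ^ N * ?g N k) = (\<Sum>k\<le>N. ?g N k) * (1 + x * p ^ N)"
    by (simp only: sum_distrib_left[symmetric]) (simp add: algebra_simps)
  also have "\<dots> = (\<Prod>k<Suc N. 1 + x * p ^ k)"
    using Suc.IH by simp
  finally show ?case ..
qed

section \<open>Ramanujan's two-variable theta series\<close>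

definition theta_term :: "real \<Rightarrow> real \<Rightarrow> int \<Rightarrow> real" where
  "theta_term a b n = a powi (n * (n + 1) div 2) * b powi (n * (n - 1) div 2)"

definition ramanujan_theta :: "real \<Rightarrow> real \<Rightarrow> real" where
  "ramanujan_theta a b = (\<Sum>\<^sub>\<infinity>n. theta_term a b n)"

text \<open>From n(n+1)/2 = n + n(n-1)/2. In this form the decay is quadratic in the exponent of ab,
  so |ab| < 1 alone gives convergence, whatever the size of a.\<close>

lemma theta_term_of_nat: "theta_term a b (int k) = a ^ k * (a * b) ^ (k * (k - 1) div 2)"
proof -
  have 1: "int k * (int k - 1) div 2 = int (k * (k - 1) div 2)"
  proof -
    have "int k * (int k - 1) = int (k * (k - 1))"
      by (cases k) (simp_all add: algebra_simps)
    then show ?thesis by (simp only: zdiv_int of_nat_numeral)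
  qed
  have "int k * (int k + 1) = int k * (int k - 1) + int k * 2" by (simp add: algebra_simps)
  then have "int k * (int k + 1) div 2 = int (k + k * (k - 1) div 2)"
    using 1 by simp
  with 1 show ?thesis
    by (simp add: theta_term_def power_add power_mult_distrib flip: of_nat_add)
qed

lemma theta_term_uminus: "theta_term a b (- n) = theta_term b a n"
  by (simp add: theta_term_def algebra_simps)

lemma theta_term_uminus_of_nat: "theta_term a b (- int k) = b ^ k * (a * b) ^ (k * (k - 1) div 2)"
  unfolding theta_term_uminus theta_term_of_nat by (simp add: mult.commute)

text \<open>The ratio of consecutive terms has absolute value |a| |p|^k, which tends to 0 and so is
  eventually below 1/2.\<close>

lemma summable_theta_nat:
  fixes a p :: real
  assumes "\<bar>p\<bar> < 1"
  shows "summable (\<lambda>k. norm (a ^ k * p ^ (k * (k - 1) div 2)))"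
proof -
  have "(\<lambda>k. \<bar>a\<bar> * \<bar>p\<bar> ^ k) \<longlonglongrightarrow> \<bar>a\<bar> * 0"
    using assms by (intro tendsto_intros LIMSEQ_realpow_zero) auto
  then have "\<forall>\<^sub>F k in sequentially. \<bar>a\<bar> * \<bar>p\<bar> ^ k < 1 / 2"
    by (rule order_tendstoD) simp
  then obtain N where N: "\<And>k. k \<ge> N \<Longrightarrow> \<bar>a\<bar> * \<bar>p\<bar> ^ k < 1 / 2"
    unfolding eventually_sequentially by blast
  show ?thesis
  proof (rule summable_ratio_test[of "1 / 2" N])
    fix k assume "k \<ge> N"
    have tri: "Suc k * (Suc k - 1) div 2 = k * (k - 1) div 2 + k"
      by (cases k) (simp_all add: algebra_simps)
    have "norm (norm (a ^ Suc k * p ^ (Suc k * (Suc k - 1) div 2)))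
        = (\<bar>a\<bar> * \<bar>p\<bar> ^ k) * norm (a ^ k * p ^ (k * (k - 1) div 2))"
      unfolding tri by (simp add: power_add abs_mult power_abs)
    also have "\<dots> \<le> 1 / 2 * norm (a ^ k * p ^ (k * (k - 1) div 2))"
      by (intro mult_right_mono less_imp_le[OF N] \<open>k \<ge> N\<close>) simp
    finally show "norm (norm (a ^ Suc k * p ^ (Suc k * (Suc k - 1) div 2)))
        \<le> 1 / 2 * norm (norm (a ^ k * p ^ (k * (k - 1) div 2)))" by simp
  qed simp
qed

text \<open>The successor in the second range keeps 0 from being counted twice, so the union is
  disjoint.\<close>

lemma UNIV_int_eq: "(UNIV :: int set) = range int \<union> range (\<lambda>k. - int (Suc k))"
proof -
  have "n \<in> range int \<union> range (\<lambda>k. - int (Suc k))" for n :: int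
    by (cases n) auto
  then show ?thesis by blast
qed

lemma theta_term_summable_norm:
  assumes "\<bar>a * b\<bar> < 1"
  shows "(\<lambda>n. norm (theta_term a b n)) summable_on UNIV"
proof -
  have "(\<lambda>k. norm (theta_term a b (int k))) summable_on UNIV"
    using summable_theta_nat[OF assms, of a]
    by (subst summable_on_UNIV_nonneg_real_iff) (simp_all add: theta_term_of_nat)
  then have 1: "(\<lambda>n. norm (theta_term a b n)) summable_on range int"
    by (subst summable_on_reindex) (simp_all add: o_def)
  have "summable (\<lambda>k. norm (theta_term a b (- int (Suc k))))"
    using summable_theta_nat[OF assms, of b] unfolding theta_term_uminus_of_nat by (subst summable_Suc_iff)
  then have "(\<lambda>k. norm (theta_term a b (- int (Suc k)))) summable_on UNIV"
    by (subst summable_on_UNIV_nonneg_real_iff) simp_all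
  then have 2: "(\<lambda>n. norm (theta_term a b n)) summable_on range (\<lambda>k. - int (Suc k))"
    by (subst summable_on_reindex) (simp_all add: o_def inj_on_def)
  show ?thesis
    unfolding UNIV_int_eq by (rule summable_on_Un_disjoint[OF 1 2]) auto
qed

lemma theta_term_summable:
  "\<bar>a * b\<bar> < 1 \<Longrightarrow> theta_term a b summable_on UNIV"
  using theta_term_summable_norm abs_summable_summable by fastforce

text \<open>An enumeration of the integers turns the unordered sum into a series, the form to which
  Tannery's theorem applies.\<close>

lemma infsum_int_decode:
  fixes f :: "int \<Rightarrow> real"
  assumes "f summable_on UNIV"
  shows "infsum f UNIV = (\<Sum>n. f (int_decode n))"
proof -
  have "((\<lambda>n. f (int_decode n)) has_sum infsum f UNIV) UNIV"
    using assms by (simp add: has_sum_reindex_bij_betw[OF bij_int_decode])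
  then show ?thesis
    by (metis has_sum_imp_sums sums_unique)
qed

text \<open>Tannery's theorem along the enumeration \<open>int_decode\<close>. The limit g inherits
  the bound M, so its sum converges as well.\<close>

lemma infsum_int_dominated_convergence:
  fixes f :: "nat \<Rightarrow> int \<Rightarrow> real"
  assumes lim: "\<And>j. (\<lambda>n. f n j) \<longlonglongrightarrow> g j"
    and bound: "\<And>n j. norm (f n j) \<le> M j"
    and M: "M summable_on UNIV"
  shows "(\<lambda>n. infsum (f n) UNIV) \<longlonglongrightarrow> infsum g UNIV"
proof -
  have sum: "h summable_on UNIV" if "\<And>j. norm (h j) \<le> M j" for h :: "int \<Rightarrow> real"
    using abs_summable_summable[of h UNIV] Infinite_Sum.summable_on_comparison_test[OF M, of "\<lambda>j. norm (h j)"] that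
    by auto
  have "summable (\<lambda>n. M (int_decode n))"
    by (intro summable_on_imp_summable)
       (simp add: summable_on_reindex_bij_betw[OF bij_int_decode] M)
  moreover have "norm (g j) \<le> M j" for j
    by (rule LIMSEQ_le_const2[OF tendsto_norm[OF lim]]) (use bound in auto)
  moreover have "infsum (f n) UNIV = (\<Sum>k. f n (int_decode k))" for n
    by (rule infsum_int_decode[OF sum]) (rule bound)
  moreover have "(\<lambda>n. \<Sum>k. f n (int_decode k)) \<longlonglongrightarrow> (\<Sum>k. g (int_decode k))"
    using tannerys_theorem[of "\<lambda>k n. f n (int_decode k)" "\<lambda>k. g (int_decode k)" sequentially "\<lambda>k. M (int_decode k)"]
      lim bound \<open>summable (\<lambda>n. M (int_decode n))\<close>
    by (simp add: case_prod_unfold)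
  ultimately show ?thesis
    using infsum_int_decode[OF sum, of g] by simp
qed

text \<open>The coefficient in the finite triple product. Both sides are monomials in a and b; with
  T(k) = k(k-1)/2 their exponents agree by T(i + j) = T(i) + T(j) + i j and i + 2 T(i) =
  i^2.\<close>

lemma finite_theta_coefficient:
  fixes a b :: real
  assumes a: "a \<noteq> 0" and b: "b \<noteq> 0"
  shows "(\<Prod>i<n. b * (a * b) ^ i) * ((a * b) ^ (k * (k - 1) div 2) * (a / (a * b) ^ n) ^ k)
           = theta_term a b (int k - int n)"
proof -
  define p where "p = a * b"
  define tri where "tri k = k * (k - 1) div 2" for k :: nat
  have p: "p \<noteq> 0" using a b by (simp add: p_def)
  have tri_Suc: "tri (Suc k) = tri k + k" for k
    by (cases k) (simp_all add: tri_def algebra_simps)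
  have tri_0: "tri 0 = 0" by (simp add: tri_def)
  have tri_add: "tri (i + j) = tri i + tri j + i * j" for i j
    by (induction j) (simp_all add: tri_Suc tri_0)
  have tri_sq: "i + tri i + tri i = i * i" for i
    by (induction i) (simp_all add: tri_Suc tri_0)
  have prod: "(\<Prod>i<n. b * p ^ i) = b ^ n * p ^ tri n"
    by (induction n) (simp_all add: tri_Suc tri_0 power_add mult_ac)
  have quot: "(a / p ^ n) ^ k = a ^ k / p ^ (n * k)"
    by (simp add: power_divide power_mult)
  have ab: "a ^ i * b ^ i = p ^ i" for i
    by (simp add: p_def power_mult_distrib)
  have "b ^ n * p ^ tri n * (p ^ tri k * (a / p ^ n) ^ k) = theta_term a b (int k - int n)"
  \<comment> \<open>Natural exponents force two cases: a surplus power of a is left when n \<le> k,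
    and one of b otherwise.\<close>
  proof (cases "n \<le> k")
    case True
    then obtain j where k: "k = n + j" using le_Suc_ex by blast
    have "n + tri n + tri k = tri j + n * k"
      unfolding k using tri_sq[of n] by (simp add: tri_add algebra_simps)
    then have e: "p ^ n * p ^ tri n * p ^ tri k = p ^ tri j * p ^ (n * k)"
      by (simp flip: power_add)
    have "b ^ n * p ^ tri n * (p ^ tri k * (a / p ^ n) ^ k)
       = a ^ j * ((p ^ n * p ^ tri n * p ^ tri k) / p ^ (n * k))"
      unfolding quot by (simp add: ab[symmetric, of n] k power_add[of a])
    also have "\<dots> = a ^ j * p ^ tri j"
      using p by (simp add: e)
    finally show ?thesis
      using theta_term_of_nat[of a b j] by (simp add: k p_def tri_def)
  next
    case False
    then obtain j where n: "n = k + j" using le_Suc_ex nat_le_linear by blast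
    have "k + tri n + tri k = tri j + n * k"
      unfolding n using tri_sq[of k] by (simp add: tri_add algebra_simps)
    then have e: "p ^ k * p ^ tri n * p ^ tri k = p ^ tri j * p ^ (n * k)"
      by (simp flip: power_add)
    have "b ^ n * p ^ tri n * (p ^ tri k * (a / p ^ n) ^ k)
       = b ^ j * ((p ^ k * p ^ tri n * p ^ tri k) / p ^ (n * k))"
      unfolding quot by (simp add: ab[symmetric, of k] n power_add[of b])
    also have "\<dots> = b ^ j * p ^ tri j"
      using p by (simp add: e)
    finally show ?thesis
      using theta_term_uminus_of_nat[of a b j] by (simp add: n p_def tri_def)
  qed
  then show ?thesis
    using prod by (simp add: p_def tri_def)
qed

text \<open>This is the q-binomial theorem of order 2n with p = ab at the point \<open>a / p ^ n\<close>: the lower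
  half of the factors reproduces the product in b because b = p / a.\<close>

lemma finite_triple_product:
  fixes a b :: real
  assumes p: "\<bar>a * b\<bar> < 1" and a: "a \<noteq> 0" and b: "b \<noteq> 0"
  shows "(\<Prod>i<n. 1 + a * (a * b) ^ i) * (\<Prod>i<n. 1 + b * (a * b) ^ i)
     = (\<Sum>k\<le>2 * n. gauss_binomial (a * b) (2 * n) k * theta_term a b (int k - int n))"
proof -
  define p where "p = a * b"
  define x where "x = a / p ^ n"
  have p0: "p \<noteq> 0" using a b by (simp add: p_def)
  have split: "(\<Prod>i<2 * n. 1 + x * p ^ i) = (\<Prod>i<n. 1 + x * p ^ i) * (\<Prod>i<n. 1 + x * p ^ (n + i))"
  proof -
    have "(\<Prod>i<n + m. 1 + x * p ^ i) = (\<Prod>i<n. 1 + x * p ^ i) * (\<Prod>i<m. 1 + x * p ^ (n + i))" for m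
      by (induction m) (simp_all add: mult.assoc)
    then show ?thesis by (simp add: mult_2)
  qed
  have hi: "(\<Prod>i<n. 1 + x * p ^ (n + i)) = (\<Prod>i<n. 1 + a * p ^ i)"
    using p0 by (simp add: x_def power_add)
  \<comment> \<open>In reversed order the factor with index i meets b p^i, and b p^i x p^(n-1-i) =
    1.\<close>
  have "(\<Prod>i<n. 1 + x * p ^ i) = (\<Prod>i<n. 1 + x * p ^ (n - Suc i))"
    by (rule prod.nat_diff_reindex[symmetric])
  then have "(\<Prod>i<n. b * p ^ i) * (\<Prod>i<n. 1 + x * p ^ i) = (\<Prod>i<n. b * p ^ i * (1 + x * p ^ (n - Suc i)))"
    by (simp add: prod.distrib)
  also have "\<dots> = (\<Prod>i<n. 1 + b * p ^ i)"
  proof (rule prod.cong[OF refl])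
    fix i assume "i \<in> {..<n}"
    then have "p ^ n = p * p ^ i * p ^ (n - Suc i)"
      by (metis lessThan_iff Suc_leI le_add_diff_inverse power_Suc power_add)
    then have "b * p ^ i * x * p ^ (n - Suc i) = 1"
      using a b p0 by (simp add: x_def p_def field_simps)
    then show "b * p ^ i * (1 + x * p ^ (n - Suc i)) = 1 + b * p ^ i"
      by (simp add: algebra_simps)
  qed
  finally have lo: "(\<Prod>i<n. b * p ^ i) * (\<Prod>i<n. 1 + x * p ^ i) = (\<Prod>i<n. 1 + b * p ^ i)" .
  have "(\<Prod>i<n. 1 + a * p ^ i) * (\<Prod>i<n. 1 + b * p ^ i)
      = (\<Prod>i<n. b * p ^ i) * (\<Prod>i<2 * n. 1 + x * p ^ i)"
    unfolding split hi lo[symmetric] by (simp only: mult_ac)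
  also have "\<dots> = (\<Sum>k\<le>2 * n. gauss_binomial p (2 * n) k *
       ((\<Prod>i<n. b * p ^ i) * (p ^ (k * (k - 1) div 2) * x ^ k)))"
    using p unfolding q_binomial_theorem[OF p[folded p_def]] sum_distrib_left
    by (intro sum.cong refl) (simp only: mult_ac)
  also have "\<dots> = (\<Sum>k\<le>2 * n. gauss_binomial p (2 * n) k * theta_term a b (int k - int n))"
    unfolding x_def p_def finite_theta_coefficient[OF a b] ..
  finally show ?thesis by (simp only: p_def)
qed

text \<open>Let n tend to infinity in the finite triple product. The coefficient of each fixed theta
  term tends to 1 / (p; p) with p = ab and (p; p) the infinite product, and dominated convergence
  moves the limit inside the sum.\<close>

theorem jacobi_triple_product:
  fixes a b :: real
  assumes p: "\<bar>a * b\<bar> < 1" and a: "a \<noteq> 0" and b: "b \<noteq> 0"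
  shows "ramanujan_theta a b = q_pochhammer_inf (- a) (a * b) * q_pochhammer_inf (- b) (a * b)
            * q_pochhammer_inf (a * b) (a * b)"
proof -
  define p where "p = a * b"
  define Q where "Q = q_pochhammer_inf p p"
  have p1: "\<bar>p\<bar> < 1" using p by (simp add: p_def)
  have Q: "Q > 0" unfolding Q_def by (intro q_pochhammer_inf_pos p1)
  have Qlim: "q_fact p \<longlonglongrightarrow> Q"
    using q_pochhammer_inf_LIMSEQ(1)[OF p1, of p] by (simp add: Q_def q_fact_def[abs_def])
  have Qinv: "(\<lambda>n. inverse (q_fact p n)) \<longlonglongrightarrow> inverse Q"
    using Q by (intro tendsto_inverse Qlim) simp
  obtain B1 where B1: "B1 > 0" "\<And>n. norm (q_fact p n) \<le> B1"
    using convergent_imp_Bseq[OF convergentI[OF Qlim]] BseqE by blast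
  obtain B2 where B2: "B2 > 0" "\<And>n. norm (inverse (q_fact p n)) \<le> B2"
    using convergent_imp_Bseq[OF convergentI[OF Qinv]] BseqE by blast
  define B where "B = B1 * (B2 * B2)"
  \<comment> \<open>A bound uniform in N and k: both \<open>q_fact\<close> and its inverse converge,
    hence are bounded.\<close>
  have gb: "norm (gauss_binomial p N k) \<le> B" for N k
  proof (cases "k \<le> N")
    case True
    have "norm (q_fact p N * (inverse (q_fact p k) * inverse (q_fact p (N - k)))) \<le> B"
      unfolding B_def norm_mult using B1 B2 by (intro mult_mono) auto
    then show ?thesis using True by (simp add: gauss_binomial_def field_simps)
  qed (use B1 B2 in \<open>simp add: gauss_binomial_def B_def\<close>)
  \<comment> \<open>Extension by 0 outside -n..n, so that the sums for all n run over the same index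
    set.\<close>
  define c where "c n j = (if j \<in> {- int n..int n} then gauss_binomial p (2 * n) (nat (int n + j)) else 0)" for n j
  have fin: "(\<Prod>i<n. 1 + a * p ^ i) * (\<Prod>i<n. 1 + b * p ^ i) = (\<Sum>\<^sub>\<infinity>j. c n j * theta_term a b j)" for n
  proof -
    have "(\<Prod>i<n. 1 + a * p ^ i) * (\<Prod>i<n. 1 + b * p ^ i)
       = (\<Sum>k\<le>2 * n. gauss_binomial p (2 * n) k * theta_term a b (int k - int n))"
      unfolding p_def by (rule finite_triple_product[OF assms])
    also have "\<dots> = (\<Sum>j\<in>{- int n..int n}. gauss_binomial p (2 * n) (nat (int n + j)) * theta_term a b j)"
      by (rule sum.reindex_bij_witness[of _ "\<lambda>j. nat (int n + j)" "\<lambda>k. int k - int n"]) auto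
    also have "\<dots> = (\<Sum>j\<in>{- int n..int n}. c n j * theta_term a b j)"
      by (intro sum.cong) (auto simp: c_def)
    also have "\<dots> = (\<Sum>\<^sub>\<infinity>j\<in>{- int n..int n}. c n j * theta_term a b j)"
      by simp
    also have "\<dots> = (\<Sum>\<^sub>\<infinity>j. c n j * theta_term a b j)"
      by (rule infsum_cong_neutral) (auto simp: c_def)
    finally show ?thesis .
  qed
  have clim: "(\<lambda>n. c n j) \<longlonglongrightarrow> inverse Q" for j
  proof -
    have 2: "filterlim (\<lambda>n::nat. 2 * n) at_top sequentially"
      unfolding filterlim_at_top eventually_sequentially by (metis le_add2 mult_2 le_trans)
    have shift: "filterlim (\<lambda>n::nat. nat (int n + i)) at_top sequentially" for i
    proof -
      have "\<exists>N. \<forall>n\<ge>N. Z \<le> nat (int n + i)" for Z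
        by (rule exI[of _ "Z + nat \<bar>i\<bar>"]) auto
      then show ?thesis
        unfolding filterlim_at_top eventually_sequentially by blast
    qed
    note 3 = shift[of j]
    have 4: "filterlim (\<lambda>n::nat. nat (int n - j)) at_top sequentially"
      using shift[of "- j"] by simp
    have "(\<lambda>n. q_fact p (2 * n) * (inverse (q_fact p (nat (int n + j))) * inverse (q_fact p (nat (int n - j)))))
        \<longlonglongrightarrow> Q * (inverse Q * inverse Q)"
      by (intro tendsto_mult filterlim_compose[OF Qlim 2] filterlim_compose[OF Qinv 3] filterlim_compose[OF Qinv 4])
    moreover have "\<forall>\<^sub>F n in sequentially.
       q_fact p (2 * n) * (inverse (q_fact p (nat (int n + j))) * inverse (q_fact p (nat (int n - j)))) = c n j"
      using eventually_ge_at_top[of "nat \<bar>j\<bar>"]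
    proof eventually_elim
      case (elim n)
      then have "2 * n - nat (int n + j) = nat (int n - j)" "nat (int n + j) \<le> 2 * n" "j \<in> {- int n..int n}"
        by auto
      then show ?case by (simp add: c_def gauss_binomial_def divide_inverse)
    qed
    moreover have "Q * (inverse Q * inverse Q) = inverse Q"
      using Q by simp
    ultimately show ?thesis
      by (simp only: tendsto_cong)
  qed
  have "(\<lambda>n. \<Sum>\<^sub>\<infinity>j. c n j * theta_term a b j) \<longlonglongrightarrow> (\<Sum>\<^sub>\<infinity>j. inverse Q * theta_term a b j)"
  proof (rule infsum_int_dominated_convergence)
    show "(\<lambda>n. c n j * theta_term a b j) \<longlonglongrightarrow> inverse Q * theta_term a b j" for j
      by (intro tendsto_mult clim tendsto_const)
    show "norm (c n j * theta_term a b j) \<le> B * norm (theta_term a b j)" for n j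
      unfolding norm_mult using gb B1 B2
      by (intro mult_right_mono) (auto simp: c_def B_def)
    show "(\<lambda>j. B * norm (theta_term a b j)) summable_on UNIV"
      by (intro summable_on_cmult_right theta_term_summable_norm p)
  qed
  moreover have "(\<lambda>n. (\<Prod>i<n. 1 + a * p ^ i) * (\<Prod>i<n. 1 + b * p ^ i))
     \<longlonglongrightarrow> q_pochhammer_inf (- a) p * q_pochhammer_inf (- b) p"
    using tendsto_mult[OF q_pochhammer_inf_LIMSEQ(1)[OF p1, of "- a"] q_pochhammer_inf_LIMSEQ(1)[OF p1, of "- b"]]
    by simp
  ultimately have "(\<Sum>\<^sub>\<infinity>j. inverse Q * theta_term a b j) = q_pochhammer_inf (- a) p * q_pochhammer_inf (- b) p"
    unfolding fin using LIMSEQ_unique by blast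
  then have "inverse Q * ramanujan_theta a b = q_pochhammer_inf (- a) p * q_pochhammer_inf (- b) p"
    by (simp add: ramanujan_theta_def infsum_cmult_right')
  then show ?thesis
    using Q unfolding Q_def p_def by (simp add: field_simps)
qed

section \<open>Dissections modulo 5\<close>

lemma infsum_mult_infsum:
  fixes f g :: "int \<Rightarrow> real"
  assumes f: "(\<lambda>n. norm (f n)) summable_on UNIV" and g: "(\<lambda>n. norm (g n)) summable_on UNIV"
  shows "(\<lambda>(x, y). f x * g y) summable_on UNIV"
    and "infsum f UNIV * infsum g UNIV = (\<Sum>\<^sub>\<infinity>(x, y). f x * g y)"
proof -
  have "(\<lambda>p. norm ((\<lambda>(x, y). f x * g y) p)) summable_on UNIV \<times> UNIV"
    unfolding Infinite_Sum.abs_summable_on_Sigma_iff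
    using f g by (auto simp: norm_mult abs_mult infsum_cmult_right' intro!: summable_on_cmult_right summable_on_cmult_left)
  then have s: "(\<lambda>(x, y). f x * g y) summable_on UNIV \<times> UNIV"
    by (rule abs_summable_summable)
  then show "(\<lambda>(x, y). f x * g y) summable_on UNIV" by simp
  have "infsum f UNIV * infsum g UNIV = (\<Sum>\<^sub>\<infinity>x. \<Sum>\<^sub>\<infinity>y. f x * g y)"
    by (simp add: infsum_cmult_right' infsum_cmult_left')
  also have "\<dots> = (\<Sum>\<^sub>\<infinity>(x, y)\<in>UNIV \<times> UNIV. f x * g y)"
    by (rule infsum_Sigma'_banach[OF s])
  finally show "infsum f UNIV * infsum g UNIV = (\<Sum>\<^sub>\<infinity>(x, y). f x * g y)" by simp
qed

text \<open>Since 2 generates the units modulo 5, a symmetry that doubles the residue c permutes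
  the four nonzero residue classes cyclically.\<close>

lemma infsum_dissect_mod_5:
  fixes F :: "'a \<Rightarrow> real" and c :: "'a \<Rightarrow> int"
  assumes F: "F summable_on UNIV"
    and inv: "\<And>p. \<sigma> (\<tau> p) = p" "\<And>p. \<tau> (\<sigma> p) = p"
    and F\<sigma>: "\<And>p. F (\<sigma> p) = F p"
    and c\<sigma>: "\<And>p. c (\<sigma> p) mod 5 = 2 * c p mod 5"
    and k: "k \<in> {1, 2, 3, 4}"
  shows "infsum F UNIV = infsum F {p. c p mod 5 = 0} + 4 * infsum F {p. c p mod 5 = k}"
proof -
  define A where "A i = {p. c p mod 5 = i}" for i
  have rot: "infsum F (A i) = infsum F (A j)" if "j = 2 * i mod 5" "i \<in> {1, 2, 3, 4}" for i j
  proof (rule infsum_reindex_bij_witness[of _ \<tau> \<sigma>])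
    \<comment> \<open>Since 2 is invertible modulo 5, doubling can be undone; this is needed for the
      inverse map \<open>\<tau>\<close>.\<close>
    have double: "2 * x mod 5 = 2 * i mod 5 \<longleftrightarrow> x mod 5 = i" for x
    proof -
      have "2 * x mod 5 = 2 * i mod 5 \<longleftrightarrow> 5 dvd 2 * (x - i)"
        by (simp add: mod_eq_dvd_iff right_diff_distrib)
      also have "\<dots> \<longleftrightarrow> 5 dvd x - i"
        by (rule coprime_dvd_mult_right_iff) simp
      also have "\<dots> \<longleftrightarrow> x mod 5 = i mod 5"
        by (simp add: mod_eq_dvd_iff)
      also have "i mod 5 = i" using \<open>i \<in> _\<close> by auto
      finally show ?thesis .
    qed
    show "\<sigma> p \<in> A j" if "p \<in> A i" for p
      using that c\<sigma>[of p] double[of "c p"] \<open>j = _\<close> by (simp add: A_def)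
    show "\<tau> p \<in> A i" if "p \<in> A j" for p
      using that c\<sigma>[of "\<tau> p"] double[of "c (\<tau> p)"] \<open>j = _\<close> by (simp add: A_def inv)
  qed (use inv F\<sigma> in auto)
  have eq: "infsum F (A 1) = infsum F (A 2)" "infsum F (A 2) = infsum F (A 4)" "infsum F (A 4) = infsum F (A 3)"
    by (rule rot; simp)+
  have sum: "F summable_on X" for X
    using summable_on_subset_banach[OF F] by blast
  have "(\<Union>i\<in>{0, 1, 2, 3, 4}. A i) = UNIV"
  proof -
    have "x mod 5 \<in> {0, 1, 2, 3, 4}" for x :: int
      by simp presburger
    then show ?thesis unfolding A_def by blast
  qed
  moreover have "(\<Sum>i\<in>{0, 1, 2, 3, 4}. infsum F (A i)) = infsum F (\<Union>i\<in>{0, 1, 2, 3, 4}. A i)"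
    by (rule sum_infsum) (auto simp: A_def sum)
  ultimately have "infsum F UNIV
      = infsum F (A 0) + (infsum F (A 1) + (infsum F (A 2) + (infsum F (A 3) + infsum F (A 4))))"
    by (simp add: numeral_eq_Suc)
  then show ?thesis
    using eq k by (auto simp: A_def)
qed

section \<open>Theta products as sums over pairs of integers\<close>

lemma two_tri: "2 * ((n::int) * (n + 1) div 2) = n * (n + 1)" "2 * ((n::int) * (n - 1) div 2) = n * (n - 1)"
  by simp_all

text \<open>Doubling removes the integer divisions, so that exponent identities become polynomial
  identities.\<close>

lemma weighted_tri_eqI:
  fixes a b d n :: int
  assumes "a * (n * (n + 1)) + b * (n * (n - 1)) = 2 * d"
  shows "a * (n * (n + 1) div 2) + b * (n * (n - 1) div 2) = d"
proof -
  have "2 * (a * (n * (n + 1) div 2) + b * (n * (n - 1) div 2)) = 2 * d"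
    unfolding distrib_left[of 2] mult.left_commute[of 2] two_tri by (rule assms)
  then show ?thesis by simp
qed

lemma square_eq_tri: "(n::int)\<^sup>2 = n * (n + 1) div 2 + n * (n - 1) div 2"
  using weighted_tri_eqI[of 1 n 1 "n\<^sup>2"] by (simp add: power2_eq_square algebra_simps)

lemma theta_term_power:
  fixes r :: real
  assumes "r \<noteq> 0"
  shows "theta_term (r ^ i) (r ^ j) n = r powi (int i * (n * (n + 1) div 2) + int j * (n * (n - 1) div 2))"
  using assms by (simp add: theta_term_def power_int_add power_int_mult)

text \<open>With all arguments powers of one r, the product becomes a lattice sum of single powers
  of r. A change of lattice coordinates then only has to be checked on the exponent.\<close>

lemma ramanujan_theta_mult_eq_infsum:
  fixes r :: real
  assumes "r \<noteq> 0" "\<bar>r\<bar> < 1" "i + j > 0" "k + l > 0"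
  shows "ramanujan_theta (r ^ i) (r ^ j) * ramanujan_theta (r ^ k) (r ^ l)
      = (\<Sum>\<^sub>\<infinity>(m, n). r powi (int i * (m * (m + 1) div 2) + int j * (m * (m - 1) div 2)
          + (int k * (n * (n + 1) div 2) + int l * (n * (n - 1) div 2))))"
    and "(\<lambda>(m, n). r powi (int i * (m * (m + 1) div 2) + int j * (m * (m - 1) div 2)
          + (int k * (n * (n + 1) div 2) + int l * (n * (n - 1) div 2)))) summable_on UNIV"
proof -
  have "\<bar>r ^ i * r ^ j\<bar> < 1" if "i + j > 0" for i j
    using assms that by (simp add: power_add[symmetric] power_abs power_less_one_iff del: power_add)
  then have s: "(\<lambda>n. norm (theta_term (r ^ i) (r ^ j) n)) summable_on UNIV" if "i + j > 0" for i j
    using that by (intro theta_term_summable_norm)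
  show "ramanujan_theta (r ^ i) (r ^ j) * ramanujan_theta (r ^ k) (r ^ l)
      = (\<Sum>\<^sub>\<infinity>(m, n). r powi (int i * (m * (m + 1) div 2) + int j * (m * (m - 1) div 2)
          + (int k * (n * (n + 1) div 2) + int l * (n * (n - 1) div 2))))"
    using infsum_mult_infsum(2)[OF s[OF assms(3)] s[OF assms(4)]] assms(1)
    by (simp add: ramanujan_theta_def theta_term_power power_int_add)
  show "(\<lambda>(m, n). r powi (int i * (m * (m + 1) div 2) + int j * (m * (m - 1) div 2)
          + (int k * (n * (n + 1) div 2) + int l * (n * (n - 1) div 2)))) summable_on UNIV"
    using infsum_mult_infsum(1)[OF s[OF assms(3)] s[OF assms(4)]] assms(1)
    by (simp add: theta_term_power power_int_add)
qed

lemma theta_phi_eq_ramanujan_theta: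
  fixes r :: real
  assumes "r \<noteq> 0"
  shows "theta_phi r = ramanujan_theta r r"
  using assms by (simp add: theta_phi_def ramanujan_theta_def theta_term_def square_eq_tri power_int_add)

text \<open>The exponent n(n+1)/2 is invariant under n -> -n-1, so the bilateral series counts each
  term of \<open>theta_psi\<close> twice.\<close>

lemma theta_psi_eq_ramanujan_theta:
  fixes q :: real
  assumes "\<bar>q\<bar> < 1"
  shows "2 * theta_psi q = ramanujan_theta q 1"
proof -
  have s: "theta_term q 1 summable_on X" for X
    using theta_term_summable[of q 1] assms summable_on_subset_banach by auto
  have pos: "theta_term q 1 (int k) = q ^ (k * (k + 1) div 2)" for k
  proof -
    have "k + k * (k - 1) div 2 = k * (k + 1) div 2"
      by (cases k) (simp_all add: algebra_simps)
    then show ?thesis by (metis mult.right_neutral power_add theta_term_of_nat)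
  qed
  have neg: "theta_term q 1 (- int (Suc k)) = q ^ (k * (k + 1) div 2)" for k
    unfolding theta_term_uminus_of_nat by (simp add: mult.commute)
  have psi: "(\<Sum>\<^sub>\<infinity>k. q ^ (k * (k + 1) div 2)) = theta_psi q"
    if "(\<lambda>k. q ^ (k * (k + 1) div 2)) summable_on UNIV"
    unfolding theta_psi_def using has_sum_imp_sums[OF has_sum_infsum[OF that]] by (simp add: sums_unique)
  have i1: "infsum (theta_term q 1) (range int) = (\<Sum>\<^sub>\<infinity>k. q ^ (k * (k + 1) div 2))"
    by (subst infsum_reindex) (simp_all add: o_def pos)
  have i2: "infsum (theta_term q 1) (range (\<lambda>k. - int (Suc k))) = (\<Sum>\<^sub>\<infinity>k. q ^ (k * (k + 1) div 2))"
    by (subst infsum_reindex) (simp_all only: o_def neg, simp add: inj_on_def)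
  have "(\<lambda>k. q ^ (k * (k + 1) div 2)) summable_on UNIV"
    using s[of "range int"] by (subst (asm) summable_on_reindex) (simp_all add: o_def pos)
  moreover have "ramanujan_theta q 1 = infsum (theta_term q 1) (range int)
      + infsum (theta_term q 1) (range (\<lambda>k. - int (Suc k)))"
    unfolding ramanujan_theta_def UNIV_int_eq by (rule infsum_Un_disjoint[OF s s]) auto
  ultimately show ?thesis using i1 i2 psi by simp
qed

text \<open>Multiplication by the Gaussian integer 2 - i, of norm 5, maps onto the lattice
  of all x + iy with 2x - y divisible by 5.\<close>

lemma infsum_sublattice_norm_5:
  fixes F :: "int \<times> int \<Rightarrow> real" and k s u v :: int
  assumes "(2 * u - v - s) mod 5 = k"
  shows "infsum F {(x, y). (2 * x - y - s) mod 5 = k} = (\<Sum>\<^sub>\<infinity>(m, n). F (2 * m + n + u, 2 * n - m + v))"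
proof -
  \<comment> \<open>The inverse map multiplies by the conjugate 2 + i and divides by 5. Divisibility
    of the first coordinate suffices, as X + 2Y = 5X - 2(2X - Y).\<close>
  have inv: "(\<lambda>(m, n). (2 * m + n + u, 2 * n - m + v))
      ((2 * (x - u) - (y - v)) div 5, ((x - u) + 2 * (y - v)) div 5) = (x, y)"
    if "(2 * x - y - s) mod 5 = k" for x y
  proof -
    have "5 dvd 2 * (x - u) - (y - v)"
      using that assms by (simp add: mod_eq_dvd_iff[of _ 5 "2 * u - v - s", unfolded assms] algebra_simps)
    then obtain m where m: "2 * (x - u) - (y - v) = 5 * m" by blast
    have n: "(x - u) + 2 * (y - v) = 5 * (x - u - 2 * m)" using m by (simp add: algebra_simps)
    show ?thesis unfolding m n using m by auto
  qed
  have mem: "(2 * (2 * m + n + u) - (2 * n - m + v) - s) mod 5 = k" for m n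
  proof -
    have "2 * (2 * m + n + u) - (2 * n - m + v) - s = (2 * u - v - s) + 5 * m" by simp
    then show ?thesis by (simp only: assms mod_mult_self2)
  qed
  show ?thesis
  proof (rule infsum_reindex_bij_witness[of _ "\<lambda>(m, n). (2 * m + n + u, 2 * n - m + v)"
      "\<lambda>(x, y). ((2 * (x - u) - (y - v)) div 5, ((x - u) + 2 * (y - v)) div 5)"], goal_cases)
    case (1 p)
    then show ?case using inv by (cases p) simp
  next
    case (4 p)
    obtain m n where p: "p = (m, n)" by fastforce
    show ?case by (simp only: p prod.case mem_Collect_eq mem)
  next
    case (5 p)
    then show ?case using inv by (cases p) simp
  qed auto
qed

text \<open>The quarter turn (x, y) -> (-y, x) preserves x^2 + y^2 and doubles 2x - y modulo 5.
  Hence the four nonzero classes contribute equally, and the zero class is the sublattice on which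
  the form is scaled by 5.\<close>

lemma phi_squared_dissection:
  fixes r :: real
  assumes "r \<noteq> 0" "\<bar>r\<bar> < 1"
  shows "(theta_phi r)\<^sup>2 = (theta_phi (r ^ 5))\<^sup>2 + 4 * r * (ramanujan_theta (r ^ 9) r * ramanujan_theta (r ^ 7) (r ^ 3))"
proof -
  define F where "F = (\<lambda>(x, y). r powi (x\<^sup>2 + y\<^sup>2))"
  have phi: "theta_phi r = ramanujan_theta (r ^ 1) (r ^ 1)"
    "theta_phi (r ^ 5) = ramanujan_theta (r ^ 5) (r ^ 5)"
    using assms by (simp_all add: theta_phi_eq_ramanujan_theta)
  have tri1: "int 1 * (m * (m + 1) div 2) + int 1 * (m * (m - 1) div 2) = m\<^sup>2" for m :: int
    by (rule weighted_tri_eqI) (simp add: power2_eq_square algebra_simps)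
  have F: "F summable_on UNIV" "(theta_phi r)\<^sup>2 = infsum F UNIV"
    using ramanujan_theta_mult_eq_infsum[OF assms, of 1 1 1 1]
    unfolding phi power2_eq_square[of "ramanujan_theta _ _"] F_def tri1 by simp_all
  \<comment> \<open>The offset \<open>- 0\<close> is the parameter s of
    \<open>infsum_sublattice_norm_5\<close>. The class 2 is chosen among the nonzero ones because it
    contains (1, 0).\<close>
  have "infsum F UNIV = infsum F {p. (case p of (x, y) \<Rightarrow> 2 * x - y - 0) mod 5 = 0}
      + 4 * infsum F {p. (case p of (x, y) \<Rightarrow> 2 * x - y - 0) mod 5 = 2}"
  proof (rule infsum_dissect_mod_5[OF F(1), of "\<lambda>(x, y). (- y, x)" "\<lambda>(x, y). (y, - x)"])
    have "(2 * (- y) - x - 0) mod 5 = 2 * (2 * x - y - 0) mod 5" for x y :: int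
    proof -
      have "2 * (- y) - x - 0 = 2 * (2 * x - y - 0) + 5 * (- x)" by simp
      then show ?thesis by (simp only: mod_mult_self2)
    qed
    then show "(case case p of (x, y) \<Rightarrow> (- y, x) of (x, y) \<Rightarrow> 2 * x - y - 0) mod 5
        = 2 * (case p of (x, y) \<Rightarrow> 2 * x - y - 0) mod 5" for p :: "int \<times> int"
      by (simp only: case_prod_unfold fst_conv snd_conv)
  qed (auto simp: F_def add.commute)
  then have "infsum F UNIV = infsum F {(x, y). (2 * x - y - 0) mod 5 = 0}
      + 4 * infsum F {(x, y). (2 * x - y - 0) mod 5 = 2}"
    by (simp only: case_prod_unfold)
  also have "infsum F {(x, y). (2 * x - y - 0) mod 5 = 0} = (theta_phi (r ^ 5))\<^sup>2"
  proof -
    have "(2 * m + n + 0)\<^sup>2 + (2 * n - m + 0)\<^sup>2 = 5 * m\<^sup>2 + 5 * n\<^sup>2" for m n :: int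
      by (simp add: power2_eq_square algebra_simps)
    moreover have tri5: "int 5 * (m * (m + 1) div 2) + int 5 * (m * (m - 1) div 2) = 5 * m\<^sup>2" for m :: int
      by (rule weighted_tri_eqI) (simp add: power2_eq_square algebra_simps)
    ultimately have "infsum F {(x, y). (2 * x - y - 0) mod 5 = 0} = (\<Sum>\<^sub>\<infinity>(m, n). r powi (5 * m\<^sup>2 + 5 * n\<^sup>2))"
      by (subst infsum_sublattice_norm_5[of 0 0]) (simp_all only: F_def prod.case, simp)
    then show ?thesis
      using ramanujan_theta_mult_eq_infsum(1)[OF assms, of 5 5 5 5]
      unfolding phi power2_eq_square[of "ramanujan_theta _ _"] tri5 by simp
  qed
  also have "infsum F {(x, y). (2 * x - y - 0) mod 5 = 2}
     = r * (ramanujan_theta (r ^ 9) r * ramanujan_theta (r ^ 7) (r ^ 3))"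
  proof -
    have "(2 * m + n + 1)\<^sup>2 + (2 * n - m + 0)\<^sup>2 = 1 + (5 * m\<^sup>2 + 4 * m + (5 * n\<^sup>2 + 2 * n))" for m n :: int
      by (simp add: power2_eq_square algebra_simps)
    then have "infsum F {(x, y). (2 * x - y - 0) mod 5 = 2}
        = (\<Sum>\<^sub>\<infinity>(m, n). r powi (1 + (5 * m\<^sup>2 + 4 * m + (5 * n\<^sup>2 + 2 * n))))"
      by (subst infsum_sublattice_norm_5[of 1 0]) (simp_all only: F_def prod.case, simp)
    also have "\<dots> = r * (\<Sum>\<^sub>\<infinity>(m, n). r powi (5 * m\<^sup>2 + 4 * m + (5 * n\<^sup>2 + 2 * n)))"
      using assms by (simp add: power_int_add[of _ 1] case_prod_unfold infsum_cmult_right')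
    finally have 1: "infsum F {(x, y). (2 * x - y - 0) mod 5 = 2}
       = r * (\<Sum>\<^sub>\<infinity>(m, n). r powi (5 * m\<^sup>2 + 4 * m + (5 * n\<^sup>2 + 2 * n)))" .
    have 2: "int 9 * (m * (m + 1) div 2) + int 1 * (m * (m - 1) div 2) = 5 * m\<^sup>2 + 4 * m" for m :: int
      by (rule weighted_tri_eqI) (simp add: power2_eq_square algebra_simps)
    have 3: "int 7 * (m * (m + 1) div 2) + int 3 * (m * (m - 1) div 2) = 5 * m\<^sup>2 + 2 * m" for m :: int
      by (rule weighted_tri_eqI) (simp add: power2_eq_square algebra_simps)
    show ?thesis
      using ramanujan_theta_mult_eq_infsum(1)[OF assms, of 9 1 7 3] unfolding 1 2 3 by simp
  qed
  finally show ?thesis using F(2) by simp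
qed

text \<open>The exponent is now symmetric about (-1/2, -1/2), so the quarter turn is taken about
  that point. The doubled series for \<open>theta_psi\<close> puts a factor 4 on the left and on the
  first term, which cancels the 4 from the nonzero classes.\<close>

lemma psi_squared_dissection:
  fixes q :: real
  assumes "q \<noteq> 0" "\<bar>q\<bar> < 1"
  shows "(theta_psi q)\<^sup>2 = q * (theta_psi (q ^ 5))\<^sup>2 + ramanujan_theta (q ^ 4) q * ramanujan_theta (q ^ 2) (q ^ 3)"
proof -
  define tri where "tri n = n * (n + 1) div 2" for n :: int
  define F where "F = (\<lambda>(x, y). q powi (tri x + tri y))"
  have tri: "2 * tri n = n * (n + 1)" for n
    by (simp add: tri_def)
  have tri_eqI: "tri x + tri y = d" if "x * (x + 1) + y * (y + 1) = 2 * d" for x y d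
    using tri[of x] tri[of y] that by linarith
  have "\<bar>q ^ 5\<bar> < 1" using assms by (simp add: power_abs power_less_one_iff)
  then have psi: "2 * theta_psi q = ramanujan_theta (q ^ 1) (q ^ 0)"
    "2 * theta_psi (q ^ 5) = ramanujan_theta (q ^ 5) (q ^ 0)"
    using assms by (simp_all add: theta_psi_eq_ramanujan_theta)
  have tri1: "int 1 * (m * (m + 1) div 2) + int 0 * (m * (m - 1) div 2) = tri m"
    and tri5: "int 5 * (m * (m + 1) div 2) + int 0 * (m * (m - 1) div 2) = 5 * tri m" for m :: int
    by (simp_all add: tri_def)
  have F: "F summable_on UNIV" "(2 * theta_psi q)\<^sup>2 = infsum F UNIV"
    using ramanujan_theta_mult_eq_infsum[OF assms, of 1 0 1 0]
    unfolding psi power2_eq_square F_def tri1 by simp_all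
  \<comment> \<open>At the centre of rotation 2x - y equals -1/2, which is 2 modulo 5; subtracting 2
    makes the turn double the residue exactly.\<close>
  have "infsum F UNIV = infsum F {p. (case p of (x, y) \<Rightarrow> 2 * x - y - 2) mod 5 = 0}
      + 4 * infsum F {p. (case p of (x, y) \<Rightarrow> 2 * x - y - 2) mod 5 = 4}"
  proof (rule infsum_dissect_mod_5[OF F(1), of "\<lambda>(x, y). (- y - 1, x)" "\<lambda>(x, y). (y, - x - 1)"])
    have "tri (- y - 1) = tri y" for y by (simp add: tri_def algebra_simps)
    then show "F (case p of (x, y) \<Rightarrow> (- y - 1, x)) = F p" for p
      by (simp add: F_def case_prod_unfold add.commute)
    have "(2 * (- y - 1) - x - 2) mod 5 = 2 * (2 * x - y - 2) mod 5" for x y :: int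
    proof -
      have "2 * (- y - 1) - x - 2 = 2 * (2 * x - y - 2) + 5 * (- x)" by simp
      then show ?thesis by (simp only: mod_mult_self2)
    qed
    then show "(case case p of (x, y) \<Rightarrow> (- y - 1, x) of (x, y) \<Rightarrow> 2 * x - y - 2) mod 5
        = 2 * (case p of (x, y) \<Rightarrow> 2 * x - y - 2) mod 5" for p :: "int \<times> int"
      by (simp only: case_prod_unfold fst_conv snd_conv)
  qed auto
  then have "infsum F UNIV = infsum F {(x, y). (2 * x - y - 2) mod 5 = 0}
      + 4 * infsum F {(x, y). (2 * x - y - 2) mod 5 = 4}"
    by (simp only: case_prod_unfold)
  also have "infsum F {(x, y). (2 * x - y - 2) mod 5 = 0} = q * (2 * theta_psi (q ^ 5))\<^sup>2"
  proof -
    have "tri (2 * m + n + 1) + tri (2 * n - m + 0) = 1 + (5 * tri m + 5 * tri n)" for m n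
      by (rule tri_eqI, unfold distrib_left[of 2] mult.left_commute[of 2] tri) (simp add: algebra_simps)
    then have "infsum F {(x, y). (2 * x - y - 2) mod 5 = 0}
        = (\<Sum>\<^sub>\<infinity>(m, n). q powi (1 + (5 * tri m + 5 * tri n)))"
      by (subst infsum_sublattice_norm_5[of 1 0]) (simp_all only: F_def prod.case, simp)
    also have "\<dots> = q * (\<Sum>\<^sub>\<infinity>(m, n). q powi (5 * tri m + 5 * tri n))"
      using assms by (simp add: power_int_add[of _ 1] case_prod_unfold infsum_cmult_right')
    finally show ?thesis
      using ramanujan_theta_mult_eq_infsum(1)[OF assms, of 5 0 5 0]
      unfolding psi power2_eq_square[of "ramanujan_theta _ _"] tri5 by simp
  qed
  also have "infsum F {(x, y). (2 * x - y - 2) mod 5 = 4}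
     = ramanujan_theta (q ^ 4) q * ramanujan_theta (q ^ 2) (q ^ 3)"
  proof -
    \<comment> \<open>The base point (0, -1) lies in the class 4 and gives an exponent without
      constant term.\<close>
    have "tri (2 * m + n + 0) + tri (2 * n - m + (- 1)) = int 4 * (m * (m + 1) div 2) + int 1 * (m * (m - 1) div 2)
           + (int 2 * (n * (n + 1) div 2) + int 3 * (n * (n - 1) div 2))" for m n
      by (rule tri_eqI, unfold distrib_left[of 2] mult.left_commute[of 2] two_tri) (simp add: algebra_simps)
    then have "infsum F {(x, y). (2 * x - y - 2) mod 5 = 4}
        = (\<Sum>\<^sub>\<infinity>(m, n). q powi (int 4 * (m * (m + 1) div 2) + int 1 * (m * (m - 1) div 2)
           + (int 2 * (n * (n + 1) div 2) + int 3 * (n * (n - 1) div 2))))"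
      by (subst infsum_sublattice_norm_5[of 0 "- 1"]) (simp_all only: F_def prod.case, simp)
    then show ?thesis
      using ramanujan_theta_mult_eq_infsum(1)[OF assms, of 4 1 2 3] by simp
  qed
  finally show ?thesis using F(2) by (simp add: power_mult_distrib)
qed

section \<open>Identities for Euler products\<close>

definition euler_prod :: "real \<Rightarrow> real" where
  "euler_prod q = q_pochhammer_inf q q"

context
  fixes q :: real
  assumes q0: "0 < q" and q1: "q < 1"
begin

lemma q_powers: "\<bar>q\<bar> < 1" "0 < n \<Longrightarrow> \<bar>q ^ n\<bar> < 1"
  using q0 q1 by (auto simp: power_less_one_iff)

lemma euler_prod_pos: "0 < n \<Longrightarrow> euler_prod (q ^ n) > 0" "euler_prod q > 0"
  unfolding euler_prod_def by (auto intro!: q_pochhammer_inf_pos q_powers)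

text \<open>The even exponents in the product for \<open>euler_prod q\<close> form
  \<open>euler_prod (q\<^sup>2)\<close>.\<close>

lemma q_pochhammer_inf_odd: "q_pochhammer_inf q (q\<^sup>2) = euler_prod q / euler_prod (q\<^sup>2)"
proof -
  have "euler_prod q = q_pochhammer_inf q (q\<^sup>2) * euler_prod (q\<^sup>2)"
    unfolding euler_prod_def
    by (subst q_pochhammer_inf_group[OF q_powers(1), of 2 q]) (simp_all add: numeral_2_eq_2)
  then show ?thesis using euler_prod_pos(1)[of 2] by simp
qed

lemma q_pochhammer_inf_neg: "q_pochhammer_inf (- q) q = euler_prod (q\<^sup>2) / euler_prod q"
  using q_pochhammer_inf_mult_minus[OF q_powers(1), of q] euler_prod_pos(2)
  by (simp add: euler_prod_def field_simps)

lemma chi_eq_euler_prod: "chi (- q) = euler_prod q / euler_prod (q\<^sup>2)"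
  by (simp add: chi_def q_pochhammer_inf_odd)

lemma theta_phi_eq_euler_prod: "theta_phi (- q) = (euler_prod q)\<^sup>2 / euler_prod (q\<^sup>2)"
proof -
  have "theta_phi (- q) = (q_pochhammer_inf q (q\<^sup>2))\<^sup>2 * euler_prod (q\<^sup>2)"
    using q0 q_powers(2)[of 2] jacobi_triple_product[of "- q" "- q"]
    by (simp add: theta_phi_eq_ramanujan_theta euler_prod_def power2_eq_square)
  then show ?thesis
    using euler_prod_pos(1)[of 2] unfolding q_pochhammer_inf_odd power_divide
    by (simp add: power2_eq_square[of "euler_prod (q\<^sup>2)"])
qed

text \<open>The triple product at (q, 1). The first factor of (-1; q) is 2 and cancels the doubling
  of \<open>theta_psi\<close>.\<close>

lemma theta_psi_eq_euler_prod: "theta_psi q = (euler_prod (q\<^sup>2))\<^sup>2 / euler_prod q"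
proof -
  have "2 * theta_psi q = q_pochhammer_inf (- q) q * q_pochhammer_inf (- 1) q * euler_prod q"
    using q0 q1 jacobi_triple_product[of q 1]
    by (simp add: theta_psi_eq_ramanujan_theta euler_prod_def)
  also have "q_pochhammer_inf (- 1) q = 2 * q_pochhammer_inf (- q) q"
    using q_pochhammer_inf_shift[OF q_powers(1), of "- 1"] by simp
  finally have "2 * theta_psi q = 2 * ((euler_prod (q\<^sup>2))\<^sup>2 / euler_prod q)"
    using euler_prod_pos(2) unfolding q_pochhammer_inf_neg
    by (simp add: power2_eq_square[of "euler_prod _"])
  then show ?thesis by simp
qed

text \<open>Both triple products have base q^5. Together they contain the residues 1 to 4 of the
  product (-q; q), so only its multiples of 5 have to be divided out.\<close>

lemma ramanujan_theta_psi_part: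
  "ramanujan_theta (q ^ 4) q * ramanujan_theta (q ^ 2) (q ^ 3)
     = euler_prod (q\<^sup>2) * euler_prod (q ^ 5) ^ 3 / (euler_prod q * euler_prod (q ^ 10))"
proof -
  let ?P = "\<lambda>k. q_pochhammer_inf (- (q ^ k)) (q ^ 5)"
  have qq: "q * q ^ 4 = q ^ 5" "q ^ 2 * q ^ 3 = q ^ 5" "q ^ 4 * q = q ^ 5"
    by (simp_all flip: power_Suc power_Suc2 power_add)
  have "q_pochhammer_inf (- q) q = ?P 1 * ?P 2 * ?P 3 * ?P 4 * ?P 5"
    by (subst q_pochhammer_inf_group[OF q_powers(1), of 5])
       (simp_all add: eval_nat_numeral mult.assoc)
  moreover have "?P 5 = euler_prod (q ^ 10) / euler_prod (q ^ 5)"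
    using q_pochhammer_inf_mult_minus[OF q_powers(2)[of 5], of "q ^ 5"] euler_prod_pos(1)[of 5]
    by (simp add: euler_prod_def field_simps flip: power_mult)
  ultimately have P: "?P 1 * ?P 2 * ?P 3 * ?P 4
      = euler_prod (q\<^sup>2) * euler_prod (q ^ 5) / (euler_prod q * euler_prod (q ^ 10))"
    using euler_prod_pos(1)[of 5] euler_prod_pos(1)[of 10] euler_prod_pos(2)
    unfolding q_pochhammer_inf_neg by (simp add: field_simps)
  have "ramanujan_theta (q ^ 4) q * ramanujan_theta (q ^ 2) (q ^ 3)
     = (?P 1 * ?P 2 * ?P 3 * ?P 4) * euler_prod (q ^ 5) ^ 2"
    using q0 q_powers(2)[of 5] jacobi_triple_product[of "q ^ 4" q] jacobi_triple_product[of "q ^ 2" "q ^ 3"]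
    unfolding qq by (simp add: euler_prod_def power2_eq_square mult_ac)
  then show ?thesis unfolding P by (simp add: power2_eq_square power3_eq_cube)
qed

text \<open>The same argument with base q^10: the residues 1, 3, 7, 9 make up (q; q^2) except for
  the odd multiples of 5. All exponents of -q are odd, which gives the factors the right
  sign.\<close>

lemma ramanujan_theta_phi_part:
  "ramanujan_theta ((- q) ^ 9) (- q) * ramanujan_theta ((- q) ^ 7) ((- q) ^ 3)
     = euler_prod q * euler_prod (q ^ 10) ^ 3 / (euler_prod (q\<^sup>2) * euler_prod (q ^ 5))"
proof -
  let ?P = "\<lambda>k. q_pochhammer_inf (q ^ k) (q ^ 10)"
  have qq: "(- (q ^ 9)) * (- q) = q ^ 10" "(- (q ^ 7)) * (- (q ^ 3)) = q ^ 10"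
    by (simp_all flip: power_Suc power_Suc2 power_add)
  have neg: "(- q) ^ 9 = - (q ^ 9)" "(- q) ^ 7 = - (q ^ 7)" "(- q) ^ 3 = - (q ^ 3)"
    by simp_all
  have "q_pochhammer_inf q (q\<^sup>2) = ?P 1 * ?P 3 * ?P 5 * ?P 7 * ?P 9"
    by (subst q_pochhammer_inf_group[OF q_powers(2), of 2 5])
       (simp_all add: eval_nat_numeral mult.assoc flip: power_mult)
  moreover have "?P 5 = euler_prod (q ^ 5) / euler_prod (q ^ 10)"
  proof -
    have "euler_prod (q ^ 5) = ?P 5 * euler_prod (q ^ 10)"
      unfolding euler_prod_def
      by (subst q_pochhammer_inf_group[OF q_powers(2), of 5 2 "q ^ 5"])
         (simp_all add: numeral_2_eq_2 flip: power_mult power_add)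
    then show ?thesis using euler_prod_pos(1)[of 10] by simp
  qed
  ultimately have P: "?P 1 * ?P 3 * ?P 7 * ?P 9
      = euler_prod q * euler_prod (q ^ 10) / (euler_prod (q\<^sup>2) * euler_prod (q ^ 5))"
    using euler_prod_pos(1)[of 5] euler_prod_pos(1)[of 10] euler_prod_pos(1)[of 2]
    unfolding q_pochhammer_inf_odd by (simp add: field_simps)
  have "ramanujan_theta ((- q) ^ 9) (- q) * ramanujan_theta ((- q) ^ 7) ((- q) ^ 3)
     = (?P 1 * ?P 3 * ?P 7 * ?P 9) * euler_prod (q ^ 10) ^ 2"
    using q0 q_powers(2)[of 10] jacobi_triple_product[of "- (q ^ 9)" "- q"]
      jacobi_triple_product[of "- (q ^ 7)" "- (q ^ 3)"]
    unfolding qq neg by (simp add: euler_prod_def power2_eq_square mult_ac)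
  then show ?thesis unfolding P by (simp add: power2_eq_square power3_eq_cube)
qed

end

lemma euler_prod_psi_identity:
  fixes q :: real
  assumes "0 < q" "q < 1"
  shows "euler_prod (q\<^sup>2) ^ 4 / (euler_prod q)\<^sup>2 = q * euler_prod (q ^ 10) ^ 4 / (euler_prod (q ^ 5))\<^sup>2
     + euler_prod (q\<^sup>2) * euler_prod (q ^ 5) ^ 3 / (euler_prod q * euler_prod (q ^ 10))"
proof -
  have q5: "0 < q ^ 5" "q ^ 5 < 1" using assms by (auto simp: power_less_one_iff)
  have "theta_psi q = (euler_prod (q\<^sup>2))\<^sup>2 / euler_prod q"
    "theta_psi (q ^ 5) = (euler_prod (q ^ 10))\<^sup>2 / euler_prod (q ^ 5)"
    using theta_psi_eq_euler_prod[OF assms] theta_psi_eq_euler_prod[OF q5] by (simp_all flip: power_mult)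
  then show ?thesis
    using psi_squared_dissection[of q] assms
    unfolding ramanujan_theta_psi_part[OF assms] by (simp add: power_divide flip: power_mult)
qed

text \<open>The dissection of \<open>theta_phi\<close> is used at -q, which makes the second term
  negative.\<close>

lemma euler_prod_phi_identity:
  fixes q :: real
  assumes "0 < q" "q < 1"
  shows "euler_prod q ^ 4 / (euler_prod (q\<^sup>2))\<^sup>2 = euler_prod (q ^ 5) ^ 4 / (euler_prod (q ^ 10))\<^sup>2
     - 4 * q * (euler_prod q * euler_prod (q ^ 10) ^ 3 / (euler_prod (q\<^sup>2) * euler_prod (q ^ 5)))"
proof -
  have q5: "0 < q ^ 5" "q ^ 5 < 1" using assms by (auto simp: power_less_one_iff)
  have neg: "(- q) ^ 5 = - (q ^ 5)" by simp
  have "theta_phi (- q) = (euler_prod q)\<^sup>2 / euler_prod (q\<^sup>2)"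
    "theta_phi (- (q ^ 5)) = (euler_prod (q ^ 5))\<^sup>2 / euler_prod (q ^ 10)"
    using theta_phi_eq_euler_prod[OF assms] theta_phi_eq_euler_prod[OF q5] by (simp_all flip: power_mult)
  then show ?thesis
    using phi_squared_dissection[of "- q"] assms
    unfolding ramanujan_theta_phi_part[OF assms] neg by (simp add: power_divide flip: power_mult)
qed

section \<open>The modular equations\<close>

text \<open>Each dissection is multiplied by the monomial that turns one of its terms into t, 1 or t
  - 1. Only positive reals occur, so the lemma serves for t at q and for u at q^2.\<close>

lemma hauptmodul_level_10:
  fixes q f1 f2 f5 f10 t :: real
  assumes pos: "q > 0" "f1 > 0" "f2 > 0" "f5 > 0" "f10 > 0"
    and psi: "f2 ^ 4 / f1\<^sup>2 = q * f10 ^ 4 / f5\<^sup>2 + f2 * f5 ^ 3 / (f1 * f10)"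
    and phi: "f1 ^ 4 / f2\<^sup>2 = f5 ^ 4 / f10\<^sup>2 - 4 * q * (f1 * f10 ^ 3 / (f2 * f5))"
    and t: "t = f2 ^ 4 * f5\<^sup>2 / (q * f1\<^sup>2 * f10 ^ 4)"
  shows "t - 1 = f2 * f5 ^ 5 / (q * f1 * f10 ^ 5)"
    and "t - 5 = f1 ^ 3 * f5 / (q * f2 * f10 ^ 3)"
proof -
  have "t = (f2 ^ 4 / f1\<^sup>2) * (f5\<^sup>2 / (q * f10 ^ 4))"
    by (simp add: t)
  also have "\<dots> = 1 + f2 * f5 ^ 5 / (q * f1 * f10 ^ 5)"
    unfolding psi using pos by (simp add: field_simps) (simp add: eval_nat_numeral)
  finally show t1: "t - 1 = f2 * f5 ^ 5 / (q * f1 * f10 ^ 5)" by simp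
  have "f1 ^ 3 * f5 / (q * f2 * f10 ^ 3) = (f1 ^ 4 / f2\<^sup>2) * (f2 * f5 / (q * f1 * f10 ^ 3))"
    using pos by (simp add: field_simps) (simp add: eval_nat_numeral)
  also have "\<dots> = (t - 1) - 4"
    unfolding phi t1 using pos by (simp add: field_simps) (simp add: eval_nat_numeral algebra_simps)
  finally show "t - 5 = f1 ^ 3 * f5 / (q * f2 * f10 ^ 3)" by simp
qed

text \<open>Squaring the relation for y eliminates y and \<open>\<Lambda>\<close> and leaves one
  polynomial equation between t and u. It factors, and its relevant factor is quadratic in
  u.\<close>

lemma modular_equation_S:
  fixes t u y \<Lambda> :: real
  assumes t: "t > 5" and u: "u > 5" and "y > 0" and "\<Lambda> > 0"
    and y: "y\<^sup>2 = u / t" and \<Lambda>: "\<Lambda>\<^sup>2 = t * (t - 1) / (t - 5)"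
    and r: "y = \<Lambda> * ((t - 5) * (u - 1) / ((t - 1) * (u - 5)))"
  shows "(y - 1 / y)\<^sup>2 = (y - 1 / y) * (\<Lambda> - 1 / \<Lambda>) - 4"
proof -
  have nz: "t \<noteq> 0" "u \<noteq> 0" "t - 1 \<noteq> 0" "t - 5 \<noteq> 0" "u - 1 \<noteq> 0" "u - 5 \<noteq> 0" "y \<noteq> 0" "\<Lambda> \<noteq> 0"
    using assms by auto
  have "u / t = t * (t - 1) / (t - 5) * ((t - 5) * (u - 1) / ((t - 1) * (u - 5)))\<^sup>2"
    using y unfolding r power_mult_distrib \<Lambda> by simp
  then have "u * (t - 1) * (u - 5)\<^sup>2 = t\<^sup>2 * (t - 5) * (u - 1)\<^sup>2"
    using nz by (simp add: divide_simps power2_eq_square) (simp add: algebra_simps)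
  \<comment> \<open>The first factor is positive for t, u > 5, so the quadratic must vanish.\<close>
  then have "((t - 1) * u - (t - 5)) * (u\<^sup>2 - (t\<^sup>2 - 4 * t + 5) * u + t\<^sup>2) = 0"
    by algebra
  moreover have "(t - 1) * u - (t - 5) > 0"
  proof -
    have "(t - 1) * u > (t - 1) * 1" using t u by (intro mult_strict_left_mono) auto
    then show ?thesis by simp
  qed
  ultimately have Q: "u\<^sup>2 - (t\<^sup>2 - 4 * t + 5) * u + t\<^sup>2 = 0" by simp
  \<comment> \<open>The difference of the two sides is -4 times the quadratic in \<open>Q\<close>.
    Divided by (u - 5)^2 it becomes the equation \<open>Kv\<close> for v.\<close>
  then have K: "(u - 1)\<^sup>2 * t * (t - 5) = (t - 1) * (u - 5)\<^sup>2 + (u - 1) * (u - 5) * (t - 1) * (t - 5)"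
    by algebra
  have "(y - 1 / y)\<^sup>2 + 4 = y\<^sup>2 + 2 + 1 / y\<^sup>2"
    using nz by (simp add: power2_eq_square field_simps)
  also have "\<dots> = u / t + 2 + t / u"
    unfolding y by simp
  \<comment> \<open>By \<open>Q\<close>, u/t + t/u = (t^2 - 4t + 5) / t.\<close>
  also have "\<dots> = (t\<^sup>2 - 2 * t + 5) / t"
    using nz Q by (simp add: divide_simps) algebra
  finally have lhs: "(y - 1 / y)\<^sup>2 + 4 = (t\<^sup>2 - 2 * t + 5) / t" .
  \<comment> \<open>Through v, both y \<open>\<Lambda>\<close> and y / \<open>\<Lambda>\<close>
    become rational without square roots, and their sum with inverses is the product S L.\<close>
  define v where "v = (u - 1) / (u - 5)"
  have v: "v \<noteq> 0" using nz by (simp add: v_def)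
  have yL: "y / \<Lambda> = (t - 5) / (t - 1) * v"
    using nz by (simp add: r v_def)
  have "y * \<Lambda> = \<Lambda>\<^sup>2 * ((t - 5) / (t - 1) * v)"
    unfolding r v_def by (simp add: power2_eq_square)
  then have yL': "y * \<Lambda> = t * v"
    unfolding \<Lambda> using nz by simp
  have Kv: "v\<^sup>2 * t * (t - 5) = (t - 1) + v * (t - 1) * (t - 5)"
  proof -
    have "u - 1 = v * (u - 5)" using nz by (simp add: v_def)
    then have "(u - 5)\<^sup>2 * (v\<^sup>2 * t * (t - 5)) = (u - 5)\<^sup>2 * ((t - 1) + v * (t - 1) * (t - 5))"
      using K by algebra
    then show ?thesis using nz by simp
  qed
  have "(y - 1 / y) * (\<Lambda> - 1 / \<Lambda>) = y * \<Lambda> + 1 / (y * \<Lambda>) - y / \<Lambda> - 1 / (y / \<Lambda>)"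
    using nz by (simp add: field_simps)
  also have "\<dots> = t * v + 1 / (t * v) - (t - 5) / (t - 1) * v - 1 / ((t - 5) / (t - 1) * v)"
    unfolding yL yL' ..
  also have "\<dots> = (t\<^sup>2 - 2 * t + 5) * ((v\<^sup>2 * t * (t - 5) - (t - 1)) / (v * t * (t - 1) * (t - 5)))"
    using nz v by (simp add: divide_simps) algebra
  also have "(v\<^sup>2 * t * (t - 5) - (t - 1)) / (v * t * (t - 1) * (t - 5)) = 1 / t"
    unfolding Kv using nz v by (simp add: divide_simps)
  finally show ?thesis using lhs by simp
qed

text \<open>T and L are odd in \<open>\<Lambda>\<close>, so T^2, T L and L^2 are rational in M =
  \<open>\<Lambda>\<^sup>2\<close> and t, hence in t alone. What remains is one polynomial
  identity.\<close>

lemma modular_equation_T: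
  fixes t X \<Lambda> :: real
  assumes t: "t > 5" and "\<Lambda> > 0"
    and \<Lambda>: "\<Lambda>\<^sup>2 = t * (t - 1) / (t - 5)" and X: "X = \<Lambda> / t\<^sup>2"
    and T: "T = 1 / (5 * X) - 5 * X" and L: "L = \<Lambda> - 1 / \<Lambda>"
  shows "25 * T\<^sup>2 = 5 * T * (L ^ 3 - 6 * L) + L ^ 4 - 37 * L\<^sup>2 - 64"
proof -
  define M where "M = \<Lambda>\<^sup>2"
  have nz: "t \<noteq> 0" "t - 1 \<noteq> 0" "t - 5 \<noteq> 0" "\<Lambda> \<noteq> 0" "M \<noteq> 0"
    using assms by (auto simp: M_def)
  have M: "M = t * (t - 1) / (t - 5)" using \<Lambda> by (simp add: M_def)
  have T5: "5 * T = (t\<^sup>2 - 25 * M / t\<^sup>2) / \<Lambda>"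
    using nz by (simp add: T X M_def field_simps power2_eq_square)
  have L1: "L = \<Lambda> * (1 - 1 / M)"
    using nz by (simp add: L M_def field_simps power2_eq_square)
  have L2: "L\<^sup>2 = M - 2 + 1 / M"
    using nz unfolding L M_def by (simp add: field_simps power2_eq_square)
  have "25 * T\<^sup>2 = (5 * T)\<^sup>2" by (simp add: power2_eq_square)
  also have "\<dots> = (t\<^sup>2 - 25 * M / t\<^sup>2)\<^sup>2 * (1 / M)"
    unfolding T5 by (simp add: power_divide M_def)
  finally have T2: "25 * T\<^sup>2 = (t\<^sup>2 - 25 * M / t\<^sup>2)\<^sup>2 * (1 / M)" .
  have "5 * T * (L ^ 3 - 6 * L) = (5 * T) * L * (L\<^sup>2 - 6)"
    by (simp add: algebra_simps eval_nat_numeral)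
  also have "\<dots> = (t\<^sup>2 - 25 * M / t\<^sup>2) * (1 - 1 / M) * (L\<^sup>2 - 6)"
    unfolding T5 L1 using nz by simp
  finally have TL: "5 * T * (L ^ 3 - 6 * L) = (t\<^sup>2 - 25 * M / t\<^sup>2) * (1 - 1 / M) * (L\<^sup>2 - 6)" .
  have L4: "L ^ 4 = (L\<^sup>2)\<^sup>2" by simp
  \<comment> \<open>P and R are numerator and denominator of M, and 5 T \<open>\<Lambda>\<close> = N
    / (t R).\<close>
  define P R N where "P = t * (t - 1)" and "R = t - 5" and "N = t ^ 3 * R - 25 * (t - 1)"
  have nz': "P \<noteq> 0" "R \<noteq> 0" using nz by (auto simp: P_def R_def)
  have M': "M = P / R" by (simp add: M P_def R_def)
  have D: "t\<^sup>2 - 25 * M / t\<^sup>2 = N / (t * R)"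
    unfolding M' P_def N_def using nz nz'
    by (simp add: field_simps) (simp add: eval_nat_numeral)
  \<comment> \<open>The claim multiplied by the common denominator t (P R)^2.\<close>
  have "N\<^sup>2 * (t - 1) * R = N * (P - R) * (P\<^sup>2 - 8 * P * R + R\<^sup>2)
      + t * ((P - R) ^ 4 - 37 * (P - R)\<^sup>2 * (P * R) - 64 * (P * R)\<^sup>2)"
    unfolding N_def P_def R_def by algebra
  moreover have "(N / (t * R))\<^sup>2 * (1 / M) = N\<^sup>2 * (t - 1) * R / (t * (P * R)\<^sup>2)"
    unfolding M' using nz nz' by (simp add: field_simps) (simp add: P_def eval_nat_numeral algebra_simps)
  moreover have "N / (t * R) * (1 - 1 / M) * (L\<^sup>2 - 6)
      = N * (P - R) * (P\<^sup>2 - 8 * P * R + R\<^sup>2) / (t * (P * R)\<^sup>2)"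
    unfolding L2 M' using nz nz' by (simp add: field_simps) (simp add: eval_nat_numeral algebra_simps)
  moreover have L2': "L\<^sup>2 = (P - R)\<^sup>2 / (P * R)"
    unfolding L2 M' using nz' by (simp add: field_simps power2_eq_square)
  moreover have "L ^ 4 - 37 * L\<^sup>2 - 64
      = t * ((P - R) ^ 4 - 37 * (P - R)\<^sup>2 * (P * R) - 64 * (P * R)\<^sup>2) / (t * (P * R)\<^sup>2)"
    unfolding L4 L2' using nz nz' by (simp add: field_simps) (simp add: eval_nat_numeral)
  ultimately show ?thesis
    unfolding T2 TL D by (simp only: add_divide_distrib add_diff_eq[symmetric] diff_diff_eq)
qed

section \<open>From class invariants to Euler products\<close>

theorem theorem4p5:
  fixes m \<Lambda> a b S T L :: real
  assumes "m \<in> \<rat>" and "m > 0"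
    and "\<Lambda> = (class_g (5 * m) / class_g (m / 5)) ^ 3"
    and "a = a_par m 5"
    and "b = b_par (4 * m) 5"
    and "S = sqrt (a / b) - sqrt (b / a)"
    and "T = 1 / sqrt (a * b) - sqrt (a * b)"
    and "L = \<Lambda> - 1 / \<Lambda>"
  shows "S\<^sup>2 = S * L - 4
    \<and> 25 * T\<^sup>2 = 5 * T * (L ^ 3 - 6 * L) + L ^ 4 - 37 * L\<^sup>2 - 64"
proof -
  define q where "q = exp (- pi * sqrt (m / 5))"
  \<comment> \<open>\<open>\<Lambda>\<close>, \<open>sqrt (a / b)\<close> and
    \<open>sqrt (a * b)\<close> involve half-integral powers of q, which become integral powers of
    w.\<close>
  define w where "w = sqrt q"
  have q: "0 < q" "q < 1"
    using \<open>m > 0\<close> by (simp_all add: q_def)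
  have w: "w > 0" "w\<^sup>2 = q" using q by (simp_all add: w_def)
  have q2: "0 < q\<^sup>2" "q\<^sup>2 < 1" and q5: "0 < q ^ 5" "q ^ 5 < 1" and q10: "0 < q ^ 10" "q ^ 10 < 1"
    using q by (auto simp: power_less_one_iff)
  have nome_5m: "exp (- pi * sqrt (5 * m)) = q ^ 5"
  proof -
    have "sqrt (5 * m) = sqrt (5\<^sup>2 * (m / 5))" by (simp add: power2_eq_square)
    also have "\<dots> = 5 * sqrt (m / 5)" by (simp only: real_sqrt_mult real_sqrt_abs abs_numeral)
    finally show ?thesis by (simp add: q_def exp_of_nat_mult[symmetric] algebra_simps)
  qed
  \<comment> \<open>The index 4m of b doubles the exponent of the nome, which is why t at q^2
    enters.\<close>
  have nome_4m: "exp (- pi * sqrt (4 * m / 5)) = q\<^sup>2"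
  proof -
    have "sqrt (4 * m / 5) = sqrt (2\<^sup>2 * (m / 5))" by simp
    also have "\<dots> = 2 * sqrt (m / 5)" by (simp only: real_sqrt_mult real_sqrt_abs abs_numeral)
    finally show ?thesis by (simp add: q_def exp_of_nat_mult[symmetric] algebra_simps)
  qed
  define f1 f2 f4 f5 f10 f20 where
    "f1 = euler_prod q" and "f2 = euler_prod (q\<^sup>2)" and "f4 = euler_prod (q ^ 4)" and
    "f5 = euler_prod (q ^ 5)" and "f10 = euler_prod (q ^ 10)" and "f20 = euler_prod (q ^ 20)"
  note f_defs = f1_def f2_def f4_def f5_def f10_def f20_def
  have f: "f1 > 0" "f2 > 0" "f4 > 0" "f5 > 0" "f10 > 0" "f20 > 0"
    unfolding f_defs using euler_prod_pos[OF q] by auto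
  have psi: "theta_psi q = f2\<^sup>2 / f1" "theta_psi (q\<^sup>2) = f4\<^sup>2 / f2"
    "theta_psi (q ^ 5) = f10\<^sup>2 / f5" "theta_psi (q ^ 10) = f20\<^sup>2 / f10"
    and phi: "theta_phi (- (q\<^sup>2)) = f2\<^sup>2 / f4" "theta_phi (- (q ^ 10)) = f10\<^sup>2 / f20"
    and chi: "chi (- q) = f1 / f2" "chi (- (q ^ 5)) = f5 / f10"
    using theta_psi_eq_euler_prod[OF q] theta_psi_eq_euler_prod[OF q2]
      theta_psi_eq_euler_prod[OF q5] theta_psi_eq_euler_prod[OF q10]
      theta_phi_eq_euler_prod[OF q2] theta_phi_eq_euler_prod[OF q10]
      chi_eq_euler_prod[OF q] chi_eq_euler_prod[OF q5]
    by (simp_all add: f_defs flip: power_mult)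
  \<comment> \<open>The constants 2^(-1/4) cancel, and the powers of q combine to q^(-4/24), whose
    cube is q^(-1/2) = 1/w.\<close>
  have \<Lambda>: "\<Lambda> = (f5 * f2 / (f10 * f1)) ^ 3 / w"
  proof -
    have "class_g (5 * m) / class_g (m / 5) = ((q ^ 5) powr (- 1 / 24) / q powr (- 1 / 24)) * (f5 * f2 / (f10 * f1))"
      unfolding class_g_def Let_def nome_5m q_def[symmetric] chi by simp
    also have "(q ^ 5) powr (- 1 / 24) / q powr (- 1 / 24) = q powr (- 1 / 6)"
    proof -
      have "q ^ 5 = q powr 5" using q by (simp add: powr_numeral)
      then show ?thesis by (simp add: powr_powr flip: powr_diff)
    qed
    finally have "\<Lambda> = (q powr (- 1 / 6)) ^ 3 * (f5 * f2 / (f10 * f1)) ^ 3"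
      unfolding assms(3) by (simp only: power_mult_distrib)
    also have "(q powr (- 1 / 6)) ^ 3 = q powr (- (1 / 2))"
      using q by (simp add: powr_power)
    also have "\<dots> = 1 / w"
      using q by (simp add: powr_minus_divide powr_half_sqrt w_def)
    finally show ?thesis by simp
  qed
  have a: "a = 5 * q * (f10\<^sup>2 / f5)\<^sup>2 * (f10\<^sup>2 / f20)\<^sup>2 / ((f2\<^sup>2 / f1)\<^sup>2 * (f2\<^sup>2 / f4)\<^sup>2)"
  proof -
    have "q powr 5 = q ^ 5" "q powr (2 * 5) = q ^ 10" "q powr ((5 - 1) / 4) = q"
      using q by (simp_all add: powr_numeral)
    then show ?thesis
      unfolding assms(4) a_par_def Let_def q_def[symmetric] by (simp add: psi phi)
  qed
  have b: "b = 5 * q\<^sup>2 * (f20\<^sup>2 / f10)\<^sup>2 * (f10\<^sup>2 / f20)\<^sup>2 / ((f4\<^sup>2 / f2)\<^sup>2 * (f2\<^sup>2 / f4)\<^sup>2)"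
  proof -
    have "(q\<^sup>2) powr 5 = q ^ 10" "(q\<^sup>2) powr ((5 - 1) / 4) = q\<^sup>2"
      using q by (simp_all add: powr_numeral flip: power_mult)
    then show ?thesis
      unfolding assms(5) b_par_def Let_def nome_4m by (simp add: psi phi)
  qed
  define y where "y = f1 * f4\<^sup>2 * f10 ^ 3 / (w * f5 * f20\<^sup>2 * f2 ^ 3)"
  define X where "X = w ^ 3 * f1 * f10 ^ 5 / (f5 * f2 ^ 5)"
  have y: "y > 0" and X: "X > 0" using f w by (simp_all add: y_def X_def)
  \<comment> \<open>The factors from \<open>theta_phi\<close> agree in a and b, so only quotients of
    \<open>theta_psi\<close> remain.\<close>
  have "a / b = y\<^sup>2"
    unfolding a b y_def w(2)[symmetric] using f w(1)
    by (simp add: field_simps)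
  moreover from this have "b / a = (1 / y)\<^sup>2"
    by (metis inverse_divide inverse_eq_divide power_one_over)
  ultimately have sqrt_y: "sqrt (a / b) = y" "sqrt (b / a) = 1 / y"
    using y by simp_all
  have "a * b = (5 * X)\<^sup>2"
    unfolding a b X_def w(2)[symmetric] using f w(1)
    by (simp add: field_simps)
  then have sqrt_X: "sqrt (a * b) = 5 * X"
    using X by (simp only: real_sqrt_abs)
  define t where "t = f2 ^ 4 * f5\<^sup>2 / (q * f1\<^sup>2 * f10 ^ 4)"
  define u where "u = f4 ^ 4 * f10\<^sup>2 / (q\<^sup>2 * f2\<^sup>2 * f20 ^ 4)"
  have t: "t - 1 = f2 * f5 ^ 5 / (q * f1 * f10 ^ 5)" "t - 5 = f1 ^ 3 * f5 / (q * f2 * f10 ^ 3)"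
    using hauptmodul_level_10[OF q(1) f(1,2,4,5) _ _ t_def]
      euler_prod_psi_identity[OF q] euler_prod_phi_identity[OF q] unfolding f_defs by blast+
  have u: "u - 1 = f4 * f10 ^ 5 / (q\<^sup>2 * f2 * f20 ^ 5)" "u - 5 = f2 ^ 3 * f10 / (q\<^sup>2 * f4 * f20 ^ 3)"
    using hauptmodul_level_10[OF q2(1) f(2,3,5,6) _ _ u_def]
      euler_prod_psi_identity[OF q2] euler_prod_phi_identity[OF q2]
    unfolding f_defs by (simp_all flip: power_mult)
  \<comment> \<open>The product formulas for t - 5 and u - 5 show positivity, which the modular
    equations require.\<close>
  have "t - 5 > 0" "u - 5 > 0" unfolding t u using f q by simp_all
  then have tu: "t > 5" "u > 5" by simp_all
  have "\<Lambda> > 0" unfolding \<Lambda> using f w by simp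
  have \<Lambda>2: "\<Lambda>\<^sup>2 = t * (t - 1) / (t - 5)"
    unfolding t unfolding t_def \<Lambda> w(2)[symmetric] using f w(1)
    by (simp add: field_simps; simp add: eval_nat_numeral)
  have y2: "y\<^sup>2 = u / t"
    unfolding u_def t_def y_def w(2)[symmetric] using f w(1)
    by (simp add: field_simps; simp add: eval_nat_numeral)
  \<comment> \<open>A second expression for y / \<open>\<Lambda>\<close>, independent of
    \<open>y2\<close> and \<open>\<Lambda>2\<close>; it is what ties u to t.\<close>
  have r: "y = \<Lambda> * ((t - 5) * (u - 1) / ((t - 1) * (u - 5)))"
    unfolding u t y_def \<Lambda> w(2)[symmetric] using f w(1)
    by (simp add: field_simps; simp add: eval_nat_numeral)
  have XL: "X = \<Lambda> / t\<^sup>2"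
    unfolding t_def X_def \<Lambda> w(2)[symmetric] using f w(1)
    by (simp add: field_simps; simp add: eval_nat_numeral)
  have "S\<^sup>2 = S * L - 4"
    using modular_equation_S[OF tu y \<open>\<Lambda> > 0\<close> y2 \<Lambda>2 r] by (simp only: assms(6,8) sqrt_y)
  moreover have "25 * T\<^sup>2 = 5 * T * (L ^ 3 - 6 * L) + L ^ 4 - 37 * L\<^sup>2 - 64"
    using modular_equation_T[OF tu(1) \<open>\<Lambda> > 0\<close> \<Lambda>2 XL, of T L] assms(7,8) by (simp add: sqrt_X)
  ultimately show ?thesis ..
qed

end
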